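(* Let $(n_1,n,n_2)$ be an ordered Markov triple, with corresponding horoballs $H_1,H,H_2$ whose fractional Markov labels are $\frac{k_1}{n_1},\frac kn,\frac{k_2}{n_2}$ respectively, and let $L=\sqrt{9-\frac4{n^2}}$. The integral solutions $(a,c)$ to $$na^2-(3n+2k)ac+\left(3k+\frac{1+k^2}{n}\right)c^2=-n$$ that satisfy $\frac kn\le\frac ac\le 3+\frac kn$ have the form $\{(a_i,c_i)\}\cup\{(a_i',c_i')\}$, where $$3+\frac{k_1}{n_1}=\frac{a_1}{c_1}<\frac{a_2}{c_2}<\cdots$$ approaches $3+\frac kn-\frac12L$, where $(c_{i+1},c_i,n)$ is an ordered Markov triple, and $\frac{a_i}{c_i}$ is the fractional Markov label $\lambda_{\mathcal{FM}}(H_i)$ on the central horoball $H_i$ from the triple, and $$\frac{k_2}{n_2}=\frac{a_1'}{c_1'}>\frac{a_2'}{c_2'}>\cdots$$ approaches $\frac kn+\frac12L$, where $(n,c_i',c_{i+1}')$ is an ordered Markov triple, with $\lambda_{\mathcal{FM}}(H_i')=\frac{a_i'}{c_i'}$, $H_i'$ being the central horoball from this triple. The solution minimizing $\frac ac$ subject to the constraint $\frac ac\ge\frac32+\frac kn$ is given by $(a_1,c_1)=\left(3n_1+\frac{kn_1-n_2}{n},\,n_1\right)$.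
   Context: Farey graph: the vertices are $\mathbb{Q}\cup\{\infty\}$, with $\infty=\frac10$ and all other fractions in lowest terms with positive denominator; $\frac pq$ and $\frac ab$ are neighbors iff $|pb-qa|=1$. The immediate precedents of $\frac pq$ are the pair $\left(\frac ab,\frac cd\right)$ with $\frac ab<\frac pq<\frac cd$ pairwise neighbors and $a+c=p$, $b+d=q$ (for integers, $\infty$ is regarded as larger than every rational). Horoballs: for $r=\frac pq\in\mathbb{Q}\cap[0,1]$ let $H_r$ be the horoball in the upper half plane tangent to $\mathbb{R}$ at $r$ of Euclidean diameter $1/q^2$; let $\mathcal H=\{H_r:r\in\mathbb{Q}\cap[0,1]\}$ and let $\lambda_{\mathcal F}(H_r)=r$. These belong to the maximal $\mathrm{PSL}(2,\mathbb{Z})$-invariant horoball packing, which also has horoballs centered at $-1$ and $\infty$. Immediate precedents are transferred from fractions to horoballs. Markov labelling: put $\lambda_{\mathcal M}=1$ on the horoballs centered at $\infty$, $0$, $-1$. If $H\in\mathcal H$ has immediate precedents $H_1,H_2$, and $K$ is the common immediate precedent of $H_1$ and $H_2$ (the horoball other than $H$ of the packing tangent to both $H_1$ and $H_2$), set $\lambda_{\mathcal M}(H)=3\lambda_{\mathcal M}(H_1)\lambda_{\mathcal M}(H_2)-\lambda_{\mathcal M}(K)$. Fractional Markov labelling: put $\lambda_{\mathcal{FM}}=\frac11$ and $\frac01$ on the horoballs centered at $\infty$ and $0$ respectively. If $H$ has immediate precedents $(H_1,H_2)$ with $\lambda_{\mathcal{FM}}(H_i)=\frac{k_i}{n_i}$,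 set $$\lambda_{\mathcal{FM}}(H)=\frac{(k_1n_1+k_2n_2)/(k_2n_1-k_1n_2)}{3n_1n_2-(k_2n_1-k_1n_2)}.$$ In lowest terms, the denominator of $\lambda_{\mathcal{FM}}(H)$ is $\lambda_{\mathcal M}(H)$. A Markov triple is a positive integer solution of $x^2+y^2+z^2=3xyz$. The Markov triple $(n_1,n,n_2)$ is called ordered if the horoballs $H_1,H,H_2\in\mathcal H$ with respective Markov labels $n_1,n,n_2$ appear consecutively with respect to their centers on $\mathbb{R}$, i.e. $\lambda_{\mathcal F}(H_1)<\lambda_{\mathcal F}(H)<\lambda_{\mathcal F}(H_2)$; here $H$ is the central horoball of the triple, and $(H_1,H_2)$ are its immediate precedents.
   Formalization: Misprints corrected: L is 3−√(9−4/n²) rather than √(9−4/n²); the ordered triples are (c_i,c_{i+1},n) and (n,c'_{i+1},c'_i), centered at H_{i+1}, H'_{i+1}; a_i/c_i = 3+λ_FM(H_i). Solutions are listed up to overall sign. *)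

theory Defs
  imports "HOL-Analysis.Analysis"
begin

datatype farey = Frac rat | Infinity

text \<open>Numerator and denominator are those of the fraction in lowest terms with positive
  denominator (this is what \<open>quotient_of\<close> returns); infinity is 1/0.\<close>

fun num :: "farey \<Rightarrow> int" where
  "num (Frac r) = fst (quotient_of r)"
| "num Infinity = 1"

fun den :: "farey \<Rightarrow> int" where
  "den (Frac r) = snd (quotient_of r)"
| "den Infinity = 0"

fun farey_less :: "farey \<Rightarrow> farey \<Rightarrow> bool" where
  "farey_less (Frac r) (Frac s) \<longleftrightarrow> r < s"
| "farey_less (Frac r) Infinity \<longleftrightarrow> True"
| "farey_less Infinity v \<longleftrightarrow> False"

definition farey_neighbors :: "farey \<Rightarrow> farey \<Rightarrow> bool" where
  "farey_neighbors u v \<longleftrightarrow> \<bar>num u * den v - den u * num v\<bar> = 1"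

definition immediate_precedents :: "farey \<Rightarrow> farey \<Rightarrow> farey \<Rightarrow> bool" where
  "immediate_precedents u v w \<longleftrightarrow>
     farey_less u w \<and> farey_less w v \<and>
     farey_neighbors u w \<and> farey_neighbors w v \<and> farey_neighbors u v \<and>
     num u + num v = num w \<and> den u + den v = den w"

text \<open>Horoballs are taken to be open. The one based at p/q has Euclidean diameter \<open>1/q\<^sup>2\<close>;
  the one based at infinity is the half plane tangent to the horoballs at the integers.\<close>

fun horoball :: "farey \<Rightarrow> complex set" where
  "horoball (Frac r) =
     ball (Complex (of_rat r) (1 / (2 * (of_int (den (Frac r)))\<^sup>2)))
          (1 / (2 * (of_int (den (Frac r)))\<^sup>2))"
| "horoball Infinity = {z. Im z > 1}"

definition packing :: "complex set set" where
  "packing = range horoball"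

definition unit_horoballs :: "complex set set" where
  "unit_horoballs = {horoball (Frac r) | r. 0 \<le> r \<and> r \<le> 1}"

definition tangent :: "complex set \<Rightarrow> complex set \<Rightarrow> bool" where
  "tangent A B \<longleftrightarrow> A \<inter> B = {} \<and> is_singleton (closure A \<inter> closure B)"

definition horoball_precedents :: "complex set \<Rightarrow> complex set \<Rightarrow> complex set \<Rightarrow> bool" where
  "horoball_precedents A B C \<longleftrightarrow>
     (\<exists>u v w. A = horoball u \<and> B = horoball v \<and> C = horoball w \<and> immediate_precedents u v w)"

definition lambda_F :: "complex set \<Rightarrow> rat" where
  "lambda_F H = (THE r. H = horoball (Frac r))"

text \<open>Both labellings are recursions along immediate precedents. They are given as inductively
  generated graphs, from which the labelling functions are read off; the functions are meaningful
  on \<open>unit_horoballs\<close> and on the horoballs carrying an initial label.\<close>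

inductive markov_label :: "complex set \<Rightarrow> int \<Rightarrow> bool" where
  "markov_label (horoball Infinity) 1"
| "markov_label (horoball (Frac 0)) 1"
| "markov_label (horoball (Frac (-1))) 1"
| "\<lbrakk> H \<in> unit_horoballs; horoball_precedents H1 H2 H;
     K \<in> packing; K \<noteq> H; tangent K H1; tangent K H2;
     markov_label H1 m1; markov_label H2 m2; markov_label K m \<rbrakk>
   \<Longrightarrow> markov_label H (3 * m1 * m2 - m)"

definition lambda_M :: "complex set \<Rightarrow> int" where
  "lambda_M H = (THE m. markov_label H m)"

inductive fractional_markov_label :: "complex set \<Rightarrow> rat \<Rightarrow> bool" where
  "fractional_markov_label (horoball Infinity) 1"
| "fractional_markov_label (horoball (Frac 0)) 0"
| "\<lbrakk> horoball_precedents H1 H2 H;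
     fractional_markov_label H1 x1; fractional_markov_label H2 x2;
     quotient_of x1 = (k1, n1); quotient_of x2 = (k2, n2) \<rbrakk>
   \<Longrightarrow> fractional_markov_label H
        ((of_int (k1 * n1 + k2 * n2) / of_int (k2 * n1 - k1 * n2)) /
         of_int (3 * n1 * n2 - (k2 * n1 - k1 * n2)))"

definition lambda_FM :: "complex set \<Rightarrow> rat" where
  "lambda_FM H = (THE x. fractional_markov_label H x)"

definition markov_triple :: "int \<Rightarrow> int \<Rightarrow> int \<Rightarrow> bool" where
  "markov_triple x y z \<longleftrightarrow> x > 0 \<and> y > 0 \<and> z > 0 \<and> x\<^sup>2 + y\<^sup>2 + z\<^sup>2 = 3 * x * y * z"

text \<open>The horoballs are part of the data: a Markov number is not assumed to occur as the label
  of only one horoball.\<close>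

definition ordered_markov_triple ::
    "int \<Rightarrow> int \<Rightarrow> int \<Rightarrow> complex set \<Rightarrow> complex set \<Rightarrow> complex set \<Rightarrow> bool" where
  "ordered_markov_triple n1 n n2 H1 H H2 \<longleftrightarrow>
     markov_triple n1 n n2 \<and>
     H1 \<in> unit_horoballs \<and> H \<in> unit_horoballs \<and> H2 \<in> unit_horoballs \<and>
     lambda_M H1 = n1 \<and> lambda_M H = n \<and> lambda_M H2 = n2 \<and>
     lambda_F H1 < lambda_F H \<and> lambda_F H < lambda_F H2 \<and>
     horoball_precedents H1 H2 H"

definition integral_solutions :: "int \<Rightarrow> int \<Rightarrow> (int \<times> int) set" where
  "integral_solutions n k =
     {(a, c). real_of_int n * (real_of_int a)\<^sup>2
              - (3 * real_of_int n + 2 * real_of_int k) * real_of_int a * real_of_int c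
              + (3 * real_of_int k + (1 + (real_of_int k)\<^sup>2) / real_of_int n) * (real_of_int c)\<^sup>2
            = - real_of_int n}"

end

theory Submission
  imports Defs
begin

text \<open>
  Put \<open>z = n * a - k * c\<close>. The quadratic equation, multiplied by \<open>n\<close>, becomes the Markov equation
  \<open>z\<^sup>2 + c\<^sup>2 + n\<^sup>2 = 3 * z * c * n\<close>. So solutions, up to sign, are Markov triples \<open>(z, c, n)\<close> with
  \<open>z\<close> congruent to \<open>- k * c\<close> modulo \<open>n\<close>. Exchanging one of \<open>z\<close>, \<open>c\<close> for the other root of the Markov
  equation respects the congruence and moves the pair along a sequence with
  \<open>x\<^sub>i\<^sub>+\<^sub>1 = 3 * n * x\<^sub>i - x\<^sub>i\<^sub>-\<^sub>1\<close>. By descent each solution lies on the sequence of a triple in which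
  \<open>n\<close> is the maximum (\<open>markov_triples_on_chains\<close>), and it remains to see that this triple is the given
  one.

  For that, the labels are computed on the tree of edges that arises from the edge between 0 and 1 by
  repeatedly halving an edge at its mediant. For neighbours with labels \<open>k1 / n1\<close> and \<open>k2 / n2\<close> the
  determinant \<open>k2 * n1 - k1 * n2\<close> is the Markov label of the common neighbour preceding them
  (\<open>markov_edge_mediant\<close>, \<open>labelled_walk\<close>). Two consequences finish the argument. All Markov triples
  with maximum greater than 2 occur on the tree, up to exchanging the smaller entries
  (\<open>markov_triple_reached\<close>). The label of a mediant lies strictly between those of the ends, so an edge
  is determined by its mediant label (\<open>fm_label_walk_inj\<close>); and since \<open>k / n\<close> lies between 0 and 1/2,
  it is determined by \<open>n\<close> and the residue of \<open>k\<close> up to sign. So the residue \<open>k\<close> distinguishes triples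
  with the same maximum \<open>n\<close> (\<open>maximal_triple_unique\<close>).

  The sequence through \<open>n1, n2\<close> consists of the Markov labels of the horoballs in the two fans of
  successive mediants with \<open>H\<close>, starting at \<open>H1\<close> and at \<open>H2\<close> (\<open>left_fan_labels\<close>, \<open>right_fan_labels\<close>).
  Its consecutive ratios \<open>z / c\<close> are monotone and converge to the roots of
  \<open>t\<^sup>2 - 3 * n * t + 1\<close> (\<open>chain_ratio_limit\<close>), and \<open>a / c = k / n + (z / c) / n\<close> turns this into the
  order and the limits of the solutions.

  The labellings are defined on horoballs, so first tangency is translated into the neighbour relation
  (\<open>tangent_horoball_iff\<close>), and the labelling recursions are shown to assign at most one label to each
  horoball (\<open>markov_label_unique\<close>, \<open>fractional_markov_label_unique\<close>).
\<close>

section \<open>Farey vertices as primitive integer vectors\<close>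

lemma den_nonneg: "den u \<ge> 0"
  by (cases u) (simp_all add: less_imp_le quotient_of_denom_pos')

lemma den_eq_0_iff: "den u = 0 \<longleftrightarrow> u = Infinity"
  by (cases u) (simp_all add: less_imp_neq[OF quotient_of_denom_pos', symmetric])

lemma rat_eq_num_over_den: "r = of_int (num (Frac r)) / of_int (den (Frac r))"
  by (metis num.simps(1) den.simps(1) prod.collapse quotient_of_div)

lemma farey_eqI:
  assumes "num u = num v" "den u = den v"
  shows "u = v"
proof (cases u)
  case (Frac r)
  then obtain s where "v = Frac s"
    using assms den_eq_0_iff by (cases v) force+
  with Frac assms show ?thesis
    by (metis rat_eq_num_over_den)
next
  case Infinity
  then show ?thesis using assms(2) den_eq_0_iff[of v] by simp
qed

text \<open>A vertex is a primitive vector with nonnegative second entry, so of two opposite vectors only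
  one is a vertex; this removes the sign ambiguity of the neighbour relation.\<close>
lemma farey_not_opposite:
  assumes "num u = - num v" "den u = - den v"
  shows False
proof -
  have "den u = 0" "den v = 0"
    using assms den_nonneg[of u] den_nonneg[of v] by auto
  then show False using assms(1) by (simp add: den_eq_0_iff)
qed

lemma num_den_Frac_Fract:
  assumes "q > 0" "coprime p q"
  shows "num (Frac (Fract p q)) = p" "den (Frac (Fract p q)) = q"
  using assms by (simp_all add: quotient_of_Fract normalize_stable)

lemma farey_less_iff: "farey_less u v \<longleftrightarrow> num u * den v < num v * den u"
proof (cases u; cases v)
  fix r s assume uv: "u = Frac r" "v = Frac s"
  have pos: "den u > 0" "den v > 0"
    using uv den_nonneg[of u] den_nonneg[of v] den_eq_0_iff[of u] den_eq_0_iff[of v] by auto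
  have "r < s \<longleftrightarrow> (of_int (num u) / of_int (den u) :: rat) < of_int (num v) / of_int (den v)"
    using uv rat_eq_num_over_den[of r] rat_eq_num_over_den[of s] by simp
  also have "\<dots> \<longleftrightarrow> (of_int (num u * den v) :: rat) < of_int (num v * den u)"
    using pos by (simp add: field_simps)
  also have "\<dots> \<longleftrightarrow> num u * den v < num v * den u"
    by (rule of_int_less_iff)
  finally show ?thesis using uv by simp
qed (simp_all add: quotient_of_denom_pos' not_less less_imp_le)

lemma immediate_precedents_det:
  assumes "immediate_precedents u v w"
  shows "num w * den u - num u * den w = 1" "num v * den w - num w * den v = 1"
    "num v * den u - num u * den v = 1"
    "num w = num u + num v" "den w = den u + den v"
proof -
  have *: "farey_less u w" "farey_less w v" "farey_neighbors u w" "farey_neighbors w v"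
     "num w = num u + num v" "den w = den u + den v"
    using assms by (auto simp: immediate_precedents_def)
  show 1: "num w * den u - num u * den w = 1"
   
      using *(1,3) by (simp add: farey_less_iff farey_neighbors_def algebra_simps abs_if split: if_splits)
  show 2: "num v * den w - num w * den v = 1"
   
      using *(2,4) by (simp add: farey_less_iff farey_neighbors_def algebra_simps abs_if split: if_splits)
  show "num w = num u + num v" "den w = den u + den v" by fact+
  then show "num v * den u - num u * den v = 1" using 1 by (simp add: algebra_simps)
qed

lemma farey_det_imp_precedents:
  assumes "num v * den u - num u * den v = 1" "num w = num u + num v" "den w = den u + den v"
  shows "immediate_precedents u v w"
  using assms unfolding immediate_precedents_def farey_less_iff farey_neighbors_def
  by (simp add: algebra_simps)

text \<open>Both solutions for \<open>den u\<close> lie in the interval from 1 to \<open>den w\<close> and are congruent modulo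
  \<open>den w\<close>, because the numerators are determined by the determinant condition.\<close>
lemma immediate_precedents_unique:
  assumes "immediate_precedents u v w" "immediate_precedents u' v' w"
  shows "u = u'" "v = v'"
proof -
  note d = immediate_precedents_det[OF assms(1)] and d' = immediate_precedents_det[OF assms(2)]
  have wpos: "den w > 0"
    using d(2,4,5) den_nonneg[of v] den_nonneg[of u] den_eq_0_iff[of w] den_nonneg[of w]
    by (cases "den w = 0") auto
  have upos: "den u > 0" "den u' > 0"
    using assms den_nonneg[of u] den_nonneg[of u'] den_eq_0_iff[of u] den_eq_0_iff[of u']
    by (auto simp: immediate_precedents_def less_le)
  have le: "den u \<le> den w" "den u' \<le> den w"
    using d(5) d'(5) den_nonneg[of v] den_nonneg[of v'] by auto
  have eq: "(den u - den u') * num w = (num u - num u') * den w"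
    using d(1) d'(1) by (simp add: algebra_simps)
  have "coprime (den w) (num w)"
  proof (rule coprimeI)
    fix g assume "g dvd den w" "g dvd num w"
    then have "g dvd num w * den u - num u * den w" by simp
    then show "is_unit g" using d(1) by simp
  qed
  moreover have "den w dvd (den u - den u') * num w" using eq by simp
  ultimately have dv: "den w dvd den u - den u'" by (simp add: coprime_dvd_mult_left_iff)
  have "den u - den u' = 0"
  proof (rule ccontr)
    assume "den u - den u' \<noteq> 0"
    then have "den w \<le> \<bar>den u - den u'\<bar>" using dvd_imp_le_int[OF _ dv] by simp
    then show False using upos le by linarith
  qed
  then have "den u = den u'" "num u = num u'" using eq wpos by auto
  then show "u = u'" by (rule farey_eqI[rotated])
  show "v = v'" using \<open>den u = den u'\<close> \<open>num u = num u'\<close> d(4,5) d'(4,5)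
    by (intro farey_eqI) auto
qed

text \<open>A common neighbour of \<open>u\<close> and \<open>v\<close> is, as a vector up to sign, the sum or the difference of
  the two; the sum is \<open>w\<close>.\<close>
lemma common_neighbor_unique:
  assumes "immediate_precedents u v w"
    and "farey_neighbors t u" "farey_neighbors t v" "t \<noteq> w"
    and "farey_neighbors s u" "farey_neighbors s v" "s \<noteq> w"
  shows "s = t"
proof -
  note d = immediate_precedents_det[OF assms(1)]
  have diff: "num z * den u - den z * num u = num z * den v - den z * num v"
    if z: "farey_neighbors z u" "farey_neighbors z v" "z \<noteq> w" for z
  proof (rule ccontr)
    define e where "e = num z * den u - den z * num u"
    define f where "f = num z * den v - den z * num v"
    assume "num z * den u - den z * num u \<noteq> num z * den v - den z * num v"
    then have ef: "f = - e" "e = 1 \<or> e = -1"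
      using z(1,2) unfolding farey_neighbors_def e_def[symmetric] f_def[symmetric] by auto
    have "num z * (num v * den u - num u * den v) = e * num v - f * num u"
      "den z * (num v * den u - num u * den v) = e * den v - f * den u"
      unfolding e_def f_def by (simp_all add: algebra_simps)
    then have "num z = e * num v - f * num u" "den z = e * den v - f * den u"
      unfolding d(3) by simp_all
    then have vec: "num z = e * num w" "den z = e * den w"
      unfolding d(4,5) ef(1) by (simp_all add: algebra_simps)
    from ef(2) show False
    proof
      assume "e = 1"
      then show False using farey_eqI[of z w] vec z(3) by simp
    next
      assume "e = -1"
      then show False using farey_not_opposite[of z w] vec by simp
    qed
  qed
  have vec: "num z = (num z * den u - den z * num u) * (num v - num u)"
     "den z = (num z * den u - den z * num u) * (den v - den u)"
    if z: "farey_neighbors z u" "farey_neighbors z v" "z \<noteq> w" for z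
  proof -
    define e where "e = num z * den u - den z * num u"
    have f: "num z * den v - den z * num v = e" using diff[OF z] by (simp add: e_def)
    have "num z * (num v * den u - num u * den v)
        = (num z * den u - den z * num u) * num v - (num z * den v - den z * num v) * num u"
      "den z * (num v * den u - num u * den v)
        = (num z * den u - den z * num u) * den v - (num z * den v - den z * num v) * den u"
      by (simp_all add: algebra_simps)
    then have "num z = e * num v - e * num u" "den z = e * den v - e * den u"
      unfolding d(3) f e_def[symmetric] by simp_all
    then show "num z = (num z * den u - den z * num u) * (num v - num u)"
      "den z = (num z * den u - den z * num u) * (den v - den u)"
      unfolding e_def[symmetric] by (simp_all add: algebra_simps)
  qed
  define e where "e = num s * den u - den s * num u"
  define f where "f = num t * den u - den t * num u"
  have "num s = e * (num v - num u)" "den s = e * (den v - den u)"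
    "num t = f * (num v - num u)" "den t = f * (den v - den u)"
    unfolding e_def f_def using vec[OF assms(5-7)] vec[OF assms(2-4)] by auto
  moreover have "e = 1 \<or> e = -1" "f = 1 \<or> f = -1"
    using assms(2,5) unfolding farey_neighbors_def e_def f_def by linarith+
  ultimately have "num s = num t \<and> den s = den t \<or> num s = - num t \<and> den s = - den t"
    by auto
  then show ?thesis using farey_eqI[of s t] farey_not_opposite[of s t] by blast
qed

section \<open>Tangency of horoballs\<close>

lemma horoball_Frac:
  shows "horoball (Frac r) = ball (Complex (real_of_int (num (Frac r)) / real_of_int (den (Frac r)))
      (1 / (2 * (real_of_int (den (Frac r)))\<^sup>2))) (1 / (2 * (real_of_int (den (Frac r)))\<^sup>2))"
proof -
  have "of_rat r = real_of_int (num (Frac r)) / real_of_int (den (Frac r))"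
    by (subst rat_eq_num_over_den) (simp add: of_rat_divide)
  then show ?thesis by simp
qed

lemma dist_sq_tangent_discs:
  fixes p q a b :: real
  assumes "q > 0" "b > 0"
  shows "(dist (Complex (p/q) (1/(2*q\<^sup>2))) (Complex (a/b) (1/(2*b\<^sup>2))))\<^sup>2
     = (1/(2*q\<^sup>2) + 1/(2*b\<^sup>2))\<^sup>2 + ((p*b - q*a)\<^sup>2 - 1) / (q*b)\<^sup>2"
proof -
  have "(p/q - a/b)\<^sup>2 = (p*b - q*a)\<^sup>2 / (q*b)\<^sup>2"
    using assms by (simp add: divide_simps power_divide mult.commute)
  moreover have "(1/(2*q\<^sup>2) + 1/(2*b\<^sup>2))\<^sup>2 - (1/(2*q\<^sup>2) - 1/(2*b\<^sup>2))\<^sup>2 = 1 / (q*b)\<^sup>2"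
    by (simp add: power2_eq_square algebra_simps)
  ultimately show ?thesis
    by (simp add: dist_norm cmod_power2 diff_divide_distrib)
qed

text \<open>The point dividing the segment of centres in the ratio of the radii lies in both discs if
  they overlap, and is by strict convexity their only common point if they touch.\<close>
lemma tangent_balls_iff:
  fixes x y :: complex
  assumes "r > 0" "s > 0"
  shows "tangent (ball x r) (ball y s) \<longleftrightarrow> dist x y = r + s"
proof -
  define m where "m = x + (r / (r + s)) *\<^sub>R (y - x)"
  have "s / (r + s) = 1 - r / (r + s)" using assms by (simp add: field_simps)
  then have "x - m = (r / (r + s)) *\<^sub>R (x - y)" "y - m = (s / (r + s)) *\<^sub>R (y - x)"
    by (simp_all only: m_def) (simp_all add: algebra_simps)
  then have dist_m: "dist x m = r / (r + s) * dist x y" "dist y m = s / (r + s) * dist x y"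
    using assms by (simp_all add: dist_norm norm_minus_commute)
  show ?thesis
  proof
    assume t: "tangent (ball x r) (ball y s)"
    then have "m \<notin> ball x r \<or> m \<notin> ball y s" by (auto simp: tangent_def)
    moreover have "c / (r + s) * dist x y < c \<longleftrightarrow> dist x y < r + s" if "c > 0" for c
      using that assms by (simp add: pos_divide_less_eq)
    ultimately have "dist x y \<ge> r + s" using assms by (auto simp: dist_m)
    moreover from t obtain z where "cball x r \<inter> cball y s = {z}" using assms
      by (auto simp: tangent_def is_singleton_def)
    then have "z \<in> cball x r" "z \<in> cball y s" by blast+
    then have "dist x y \<le> r + s" using dist_triangle[of x y z] by (simp add: dist_commute)
    ultimately show "dist x y = r + s" by simp
  next
    assume d: "dist x y = r + s"
    have "z = m" if "z \<in> cball x r \<inter> cball y s" for z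
    proof -
      have "dist x z = r" "dist z y = s" "dist x y = dist x z + dist z y"
        using that d dist_triangle[of x y z] by (auto simp: dist_commute)
      then have "r *\<^sub>R (z - y) = s *\<^sub>R (x - z)" using dist_triangle_eq[of x y z]
        by (simp add: dist_norm)
      then have *: "(r + s) *\<^sub>R (z - x) = r *\<^sub>R (y - x)" by (simp add: algebra_simps)
      have "z = x + (1 / (r + s)) *\<^sub>R ((r + s) *\<^sub>R (z - x))" using assms by simp
      also have "\<dots> = m" unfolding * m_def by simp
      finally show ?thesis .
    qed
    moreover have "m \<in> cball x r \<inter> cball y s" using assms d by (simp add: dist_m)
    ultimately have "cball x r \<inter> cball y s = {m}" by blast
    then show "tangent (ball x r) (ball y s)"
      using disjoint_ballI[of r s x y] d assms by (simp add: tangent_def)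
  qed
qed

lemma closure_Im_gt: "closure {z. Im z > 1} = {z. Im z \<ge> 1}"
  using closure_halfspace_gt[of \<i> 1] by (simp add: inner_complex_def)

text \<open>The disc touches the real line, so its highest point is at height \<open>2 * r\<close>.\<close>
lemma tangent_ball_halfplane_iff:
  assumes "r > 0"
  shows "tangent (ball (Complex x r) r) {z. Im z > 1} \<longleftrightarrow> 2 * r = 1"
proof
  assume t: "tangent (ball (Complex x r) r) {z. Im z > 1}"
  from t have disj: "ball (Complex x r) r \<inter> {z. Im z > 1} = {}" by (simp add: tangent_def)
  have "2 * r \<le> 1"
  proof (rule ccontr)
    assume "\<not> 2 * r \<le> 1"
    define e where "e = max (1 - 2 * r) (- r) / 2"
    have "e < 0" "e > - r" "2 * r + e > 1" using \<open>\<not> 2 * r \<le> 1\<close> assms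
      by (auto simp: e_def max_def field_simps)
    then have "Complex x (2 * r + e) \<in> ball (Complex x r) r \<inter> {z. Im z > 1}"
      using assms by (simp add: dist_norm cmod_def)
    with disj show False by blast
  qed
  moreover from t obtain z where "cball (Complex x r) r \<inter> {z. Im z \<ge> 1} = {z}"
    using assms
    by (auto simp: tangent_def is_singleton_def closure_Im_gt)
  then have z: "z \<in> cball (Complex x r) r" "Im z \<ge> 1" by blast+
  have "\<bar>Im (Complex x r - z)\<bar> \<le> r"
    using z(1) abs_Im_le_cmod[of "Complex x r - z"] by (simp add: dist_norm)
  with z(2) have "1 \<le> 2 * r" by simp
  ultimately show "2 * r = 1" by simp
next
  assume r: "2 * r = 1"
  have "z \<notin> {z. Im z > 1}" if "z \<in> ball (Complex x r) r" for z
    using that abs_Im_le_cmod[of "Complex x r - z"] r by (simp add: dist_norm)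
  moreover have "z = Complex x 1" if "z \<in> cball (Complex x r) r" "Im z \<ge> 1" for z
  proof -
    have le: "(x - Re z)\<^sup>2 + (r - Im z)\<^sup>2 \<le> r\<^sup>2"
      using that(1) assms by (simp add: dist_norm cmod_def real_sqrt_le_iff') 
    moreover have "r\<^sup>2 \<le> (Im z - r)\<^sup>2"
      using that(2) r assms by (intro power_mono) auto
    ultimately have "(x - Re z)\<^sup>2 \<le> 0" using power2_commute[of r "Im z"] by linarith
    then have "Re z = x" by simp
    moreover have "Im z \<le> 1" using that(1) abs_Im_le_cmod[of "Complex x r - z"] r
      by (simp add: dist_norm)
    ultimately show ?thesis using that(2) by (simp add: complex_eq_iff)
  qed
  moreover have "dist (Complex x r) (Complex x 1) = \<bar>r - 1\<bar>"
    by (simp add: dist_norm cmod_def)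
  then have "Complex x 1 \<in> cball (Complex x r) r" using r by simp
  moreover have "Im (Complex x 1) \<ge> 1" by simp
  ultimately have "ball (Complex x r) r \<inter> {z. Im z > 1} = {}"
    "cball (Complex x r) r \<inter> {z. Im z \<ge> 1} = {Complex x 1}" by blast+
  then show "tangent (ball (Complex x r) r) {z. Im z > 1}"
    using assms by (simp add: tangent_def closure_Im_gt)
qed

lemma tangent_commute: "tangent A B \<longleftrightarrow> tangent B A"
  by (simp add: tangent_def Int_commute)

lemma farey_neighbors_commute: "farey_neighbors u v \<longleftrightarrow> farey_neighbors v u"
  unfolding farey_neighbors_def by (metis abs_minus_commute mult.commute)

lemma tangent_horoball_Infinity_iff:
  "tangent (horoball (Frac r)) (horoball Infinity) \<longleftrightarrow> farey_neighbors (Frac r) Infinity"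
proof -
  define q where "q = den (Frac r)"
  have q: "q > 0" using quotient_of_denom_pos' by (simp add: q_def)
  have "tangent (horoball (Frac r)) (horoball Infinity) \<longleftrightarrow> 2 * (1 / (2 * (real_of_int q)\<^sup>2)) = 1"
    unfolding horoball.simps q_def[symmetric] using q
    by (intro tangent_ball_halfplane_iff) simp
  also have "\<dots> \<longleftrightarrow> (real_of_int q)\<^sup>2 = 1"
    using q by (simp add: divide_eq_1_iff)
  also have "\<dots> \<longleftrightarrow> q\<^sup>2 = 1"
    unfolding of_int_power[symmetric] by (rule of_int_eq_1_iff)
  also have "\<dots> \<longleftrightarrow> q = 1"
    using q unfolding power2_eq_1_iff by linarith
  also have "\<dots> \<longleftrightarrow> farey_neighbors (Frac r) Infinity"
    using q by (simp add: farey_neighbors_def q_def del: den.simps(1) num.simps(1))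
  finally show ?thesis .
qed

text \<open>The squared distance of two centres exceeds the squared sum of the radii by
  \<open>((pb - qa)\<^sup>2 - 1) / (qb)\<^sup>2\<close>, which turns tangency into the neighbour relation.\<close>
lemma tangent_horoball_iff: "tangent (horoball u) (horoball v) \<longleftrightarrow> farey_neighbors u v"
proof (cases u; cases v)
  fix r s assume uv: "u = Frac r" "v = Frac s"
  define p q a b where pqab: "p = num u" "q = den u" "a = num v" "b = den v"
  have pos: "q > 0" "b > 0"
    using uv den_nonneg[of u] den_nonneg[of v] den_eq_0_iff[of u] den_eq_0_iff[of v] pqab by auto
  define x where "x = Complex (real_of_int p / real_of_int q) (1 / (2 * (real_of_int q)\<^sup>2))"
  define y where "y = Complex (real_of_int a / real_of_int b) (1 / (2 * (real_of_int b)\<^sup>2))"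
  define \<rho> \<sigma> where rs: "\<rho> = 1 / (2 * (real_of_int q)\<^sup>2)" "\<sigma> = 1 / (2 * (real_of_int b)\<^sup>2)"
  have hb: "horoball u = ball x \<rho>" "horoball v = ball y \<sigma>"
    unfolding x_def y_def rs pqab uv by (rule horoball_Frac)+
  have rs_pos: "\<rho> > 0" "\<sigma> > 0" using pos by (auto simp: rs)
  have "tangent (horoball u) (horoball v) \<longleftrightarrow> dist x y = \<rho> + \<sigma>"
    unfolding hb by (rule tangent_balls_iff[OF rs_pos])
  also have "\<dots> \<longleftrightarrow> (dist x y)\<^sup>2 = (\<rho> + \<sigma>)\<^sup>2"
    using rs_pos by (simp add: power2_eq_iff_nonneg)
  also have "\<dots> \<longleftrightarrow> ((real_of_int p * b - q * a)\<^sup>2 - 1) / (real_of_int q * b)\<^sup>2 = 0"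
    unfolding x_def y_def rs using dist_sq_tangent_discs[of q b p a] pos by simp
  also have "\<dots> \<longleftrightarrow> (real_of_int (p * b - q * a))\<^sup>2 = 1"
    using pos by simp
  also have "\<dots> \<longleftrightarrow> (p * b - q * a)\<^sup>2 = 1"
    unfolding of_int_power[symmetric] by (rule of_int_eq_1_iff)
  also have "\<dots> \<longleftrightarrow> \<bar>p * b - q * a\<bar> = 1"
    unfolding power2_eq_1_iff by linarith
  also have "\<dots> \<longleftrightarrow> farey_neighbors u v"
    by (simp add: farey_neighbors_def pqab)
  finally show ?thesis .
next
  fix r assume "u = Frac r" "v = Infinity"
  then show ?thesis using tangent_horoball_Infinity_iff by simp
next
  fix r assume "u = Infinity" "v = Frac r"
  then show ?thesis
    using tangent_horoball_Infinity_iff tangent_commute farey_neighbors_commute by metis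
next
  assume uv: "u = Infinity" "v = Infinity"
  have "2 * \<i> \<in> horoball Infinity" by simp
  then have "horoball Infinity \<inter> horoball Infinity \<noteq> {}" by blast
  then show ?thesis using uv by (simp add: tangent_def farey_neighbors_def)
qed

lemma horoball_eq_iff: "horoball u = horoball v \<longleftrightarrow> u = v"
proof
  have *: "horoball (Frac r) \<noteq> horoball Infinity" for r
  proof
    assume "horoball (Frac r) = horoball Infinity"
    then have "bounded (horoball Infinity)" by (metis bounded_ball horoball.simps(1))
    then obtain B where B: "\<And>z. z \<in> horoball Infinity \<Longrightarrow> norm z \<le> B"
      by (auto simp: bounded_iff)
    have "Complex 0 (\<bar>B\<bar> + 2) \<in> horoball Infinity" by simp
    from B[OF this] show False by (simp add: complex_norm)
  qed
  assume eq: "horoball u = horoball v"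
  show "u = v"
  proof (cases u; cases v)
    fix r s assume uv: "u = Frac r" "v = Frac s"
    have pos: "\<not> 1 / (2 * (real_of_int (den (Frac r)))\<^sup>2) \<le> 0" for r
      using quotient_of_denom_pos'[of r] by simp
    have "Complex (of_rat r) (1 / (2 * (real_of_int (den (Frac r)))\<^sup>2))
        = Complex (of_rat s) (1 / (2 * (real_of_int (den (Frac s)))\<^sup>2))"
      using eq pos[of r] unfolding uv horoball.simps ball_eq_ball_iff by blast
    then have "r = s" by simp
    then show ?thesis using uv by simp
  next
    fix r assume "u = Frac r" "v = Infinity"
    then show ?thesis using eq * by blast
  next
    fix r assume "u = Infinity" "v = Frac r"
    then show ?thesis using eq * by metis
  qed simp
qed simp

lemma lambda_F_horoball: "lambda_F (horoball (Frac r)) = r"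
  unfolding lambda_F_def by (simp add: horoball_eq_iff del: horoball.simps)

section \<open>Both labellings are functions\<close>

lemma unit_interval_iff:
  "0 \<le> r \<and> r \<le> 1 \<longleftrightarrow> 0 \<le> num (Frac r) \<and> num (Frac r) \<le> den (Frac r)"
proof -
  have q: "den (Frac r) > 0" using quotient_of_denom_pos' by simp
  have r: "r = of_int (num (Frac r)) / of_int (den (Frac r))" by (rule rat_eq_num_over_den)
  have "0 \<le> r \<longleftrightarrow> 0 \<le> num (Frac r)"
    by (subst r, use q in \<open>simp add: zero_le_divide_iff del: num.simps den.simps\<close>)
  moreover have "r \<le> 1 \<longleftrightarrow> num (Frac r) \<le> den (Frac r)"
    by (subst r, use q in \<open>simp add: divide_le_eq_1 del: num.simps den.simps\<close>)
  ultimately show ?thesis by blast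
qed

lemma horoball_unit_iff:
  "horoball u \<in> unit_horoballs \<longleftrightarrow> u \<noteq> Infinity \<and> 0 \<le> num u \<and> num u \<le> den u"
proof (cases u)
  case (Frac r)
  then show ?thesis
    using unit_interval_iff[of r] by (auto simp: unit_horoballs_def horoball_eq_iff
        simp del: horoball.simps num.simps den.simps)
next
  case Infinity
  then show ?thesis by (auto simp: unit_horoballs_def horoball_eq_iff simp del: horoball.simps)
qed

lemma not_precedents_Infinity: "\<not> immediate_precedents u v Infinity"
  by (simp add: immediate_precedents_def)

lemma precedents_of_zero:
  assumes "immediate_precedents u v (Frac 0)"
  shows "num u = -1" "den u = 1" "v = Infinity"
proof -
  note d = immediate_precedents_det[OF assms]
  have z: "num (Frac 0) = 0" "den (Frac 0) = 1" by simp_all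
  show u: "num u = -1" using d(1) unfolding z by simp
  have "den u \<noteq> 0" using u den_eq_0_iff[of u] by auto
  then show "den u = 1" using d(5) den_nonneg[of u] den_nonneg[of v] unfolding z by linarith
  then show "v = Infinity" using d(5) den_eq_0_iff[of v] unfolding z by simp
qed

text \<open>The recursion labels nothing outside the initial data and the unit interval.\<close>
lemma markov_labelled_horoball:
  assumes "markov_label H m"
  obtains u where "H = horoball u" "num u \<ge> -1"
  using assms
proof (cases rule: markov_label.cases)
  case (4 H1 H2 K m1 m2 m)
  then obtain u where "H = horoball u" by (auto simp: horoball_precedents_def)
  with 4 show ?thesis using horoball_unit_iff[of u] that by auto
qed (use that[of Infinity] that[of "Frac 0"] that[of "Frac (-1)"] in auto)

text \<open>Without this, the recursion could relabel a horoball that carries an initial label. At \<open>0\<close>,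
  with precedents \<open>-1\<close> and infinity, it would need a label at \<open>-2\<close>.\<close>
lemma markov_step_not_initial:
  assumes "immediate_precedents u v w" "horoball w \<in> unit_horoballs"
    and "t \<noteq> w" "farey_neighbors t u" "farey_neighbors t v" "markov_label (horoball t) m"
  shows "w \<notin> {Infinity, Frac 0, Frac (-1)}"
proof -
  have "w \<noteq> Infinity" using assms(1) not_precedents_Infinity by blast
  moreover have "w \<noteq> Frac (-1)" using assms(2) horoball_unit_iff[of w] by auto
  moreover have "w \<noteq> Frac 0"
  proof
    assume w: "w = Frac 0"
    note p0 = precedents_of_zero[OF assms(1)[unfolded w]]
    have "den t = 1" using assms(5) p0(3) den_nonneg[of t] by (simp add: farey_neighbors_def)
    moreover have "num t \<noteq> 0"
      using assms(3) w \<open>den t = 1\<close> farey_eqI[of t "Frac 0"] by auto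
    moreover have "num t \<ge> -1"
      using markov_labelled_horoball[OF assms(6)] by (metis horoball_eq_iff)
    ultimately show False using assms(4) p0 by (simp add: farey_neighbors_def)
  qed
  ultimately show ?thesis by blast
qed

lemma markov_label_inv:
  assumes "markov_label (horoball w) m"
  shows "w \<in> {Infinity, Frac 0, Frac (-1)} \<and> m = 1 \<or>
    w \<notin> {Infinity, Frac 0, Frac (-1)} \<and>
    (\<exists>u v t m1 m2 m0. immediate_precedents u v w \<and> t \<noteq> w \<and>
      farey_neighbors t u \<and> farey_neighbors t v \<and>
      markov_label (horoball u) m1 \<and> markov_label (horoball v) m2 \<and>
      markov_label (horoball t) m0 \<and> m = 3 * m1 * m2 - m0)"
  using assms
proof (cases rule: markov_label.cases)
  case (4 H1 H2 K m1 m2 m0)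
  obtain u v where uv: "H1 = horoball u" "H2 = horoball v" "immediate_precedents u v w"
    using 4(3) by (auto simp: horoball_precedents_def horoball_eq_iff)
  obtain t where t: "K = horoball t" using 4(4) by (auto simp: packing_def)
  have nb: "t \<noteq> w" "farey_neighbors t u" "farey_neighbors t v"
    using 4(5-7) by (auto simp: t uv horoball_eq_iff tangent_horoball_iff)
  have "w \<notin> {Infinity, Frac 0, Frac (-1)}"
    using markov_step_not_initial[OF uv(3) 4(2) nb] 4(10) t by simp
  then show ?thesis using 4 uv t nb by blast
qed (auto simp: horoball_eq_iff simp del: horoball.simps)

lemma markov_label_unique:
  assumes "markov_label H m" "markov_label H m'"
  shows "m' = m"
  using assms
proof (induction arbitrary: m' rule: markov_label.induct)
  case (4 H H1 H2 K m1 m2 m)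
  obtain u v w where uvw: "H1 = horoball u" "H2 = horoball v" "H = horoball w"
    "immediate_precedents u v w"
    using 4(2) by (auto simp: horoball_precedents_def)
  obtain t where t: "K = horoball t" using 4(3) by (auto simp: packing_def)
  have nb: "t \<noteq> w" "farey_neighbors t u" "farey_neighbors t v"
    using 4(4-6) by (auto simp: t uvw horoball_eq_iff tangent_horoball_iff)
  have "w \<notin> {Infinity, Frac 0, Frac (-1)}"
    using markov_step_not_initial[OF uvw(4) _ nb] 4(1,9) t uvw(3) by simp
  with markov_label_inv[OF 4(13)[unfolded uvw(3)]]
  show ?case
  proof (elim disjE conjE exE)
    fix u' v' t' m1' m2' m0'
    assume a: "immediate_precedents u' v' w" "t' \<noteq> w" "farey_neighbors t' u'"
      "farey_neighbors t' v'" "markov_label (horoball u') m1'" "markov_label (horoball v') m2'"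
      "markov_label (horoball t') m0'" "m' = 3 * m1' * m2' - m0'"
    have "u' = u" "v' = v" using immediate_precedents_unique[OF a(1) uvw(4)] by auto
    moreover have "t' = t"
      using common_neighbor_unique[OF uvw(4) nb(2,3,1)] a(2-4) calculation by blast
    ultimately show "m' = 3 * m1 * m2 - m" using a 4(10-12) uvw t by auto
  qed auto
qed (use markov_label_inv in \<open>blast+\<close>)

lemma lambda_M_eq: "markov_label H m \<Longrightarrow> lambda_M H = m"
  unfolding lambda_M_def using markov_label_unique by blast

text \<open>The recursion starts from \<open>0\<close> and infinity and only takes mediants, so it never reaches a
  negative fraction. This is what keeps it from relabelling \<open>0\<close>.\<close>
lemma fractional_labelled_horoball:
  assumes "fractional_markov_label H x"
  obtains u where "H = horoball u" "num u \<ge> 0"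
proof -
  from assms have "\<exists>u. H = horoball u \<and> num u \<ge> 0"
  proof induction
    case (3 H1 H2 H x1 x2 k1 n1 k2 n2)
    obtain u v w where uvw: "H1 = horoball u" "H2 = horoball v" "H = horoball w"
      "immediate_precedents u v w"
      using 3(1) by (auto simp: horoball_precedents_def)
    have "num u \<ge> 0" "num v \<ge> 0" using 3(6,7) uvw by (auto simp: horoball_eq_iff)
    then show ?case using uvw immediate_precedents_det(4)[OF uvw(4)] by auto
  qed (auto intro: exI[of _ Infinity] exI[of _ "Frac 0"])
  with that show ?thesis by blast
qed

lemma fractional_step_not_initial:
  assumes "immediate_precedents u v w" "fractional_markov_label (horoball u) x"
  shows "w \<notin> {Infinity, Frac 0}"
proof -
  have "num u \<ge> 0"
    using fractional_labelled_horoball[OF assms(2)] by (metis horoball_eq_iff)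
  then have "w \<noteq> Frac 0" using precedents_of_zero(1)[of u v] assms(1) by auto
  then show ?thesis using assms(1) not_precedents_Infinity by blast
qed

lemma fractional_markov_label_inv:
  assumes "fractional_markov_label (horoball w) x"
  shows "w = Infinity \<and> x = 1 \<or> w = Frac 0 \<and> x = 0 \<or>
    w \<notin> {Infinity, Frac 0} \<and>
    (\<exists>u v x1 x2 k1 n1 k2 n2. immediate_precedents u v w \<and>
      fractional_markov_label (horoball u) x1 \<and> fractional_markov_label (horoball v) x2 \<and>
      quotient_of x1 = (k1, n1) \<and> quotient_of x2 = (k2, n2) \<and>
      x = (of_int (k1 * n1 + k2 * n2) / of_int (k2 * n1 - k1 * n2)) /
         of_int (3 * n1 * n2 - (k2 * n1 - k1 * n2)))"
  using assms
proof (cases rule: fractional_markov_label.cases)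
  case (3 H1 H2 x1 x2 k1 n1 k2 n2)
  obtain u v where uv: "H1 = horoball u" "H2 = horoball v" "immediate_precedents u v w"
    using 3(2) by (auto simp: horoball_precedents_def horoball_eq_iff)
  have "w \<notin> {Infinity, Frac 0}"
    using fractional_step_not_initial[OF uv(3)] 3(3) uv(1) by blast
  then show ?thesis using 3 uv by blast
qed (auto simp: horoball_eq_iff simp del: horoball.simps)

lemma fractional_markov_label_unique:
  assumes "fractional_markov_label H x" "fractional_markov_label H x'"
  shows "x' = x"
  using assms
proof (induction arbitrary: x' rule: fractional_markov_label.induct)
  case (3 H1 H2 H x1 x2 k1 n1 k2 n2)
  obtain u v w where uvw: "H1 = horoball u" "H2 = horoball v" "H = horoball w"
    "immediate_precedents u v w"
    using 3(1) by (auto simp: horoball_precedents_def)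
  have "w \<notin> {Infinity, Frac 0}"
    using fractional_step_not_initial[OF uvw(4)] 3(2) uvw(1) by blast
  with fractional_markov_label_inv[OF 3(8)[unfolded uvw(3)]]
  show ?case
  proof (elim disjE conjE exE)
    fix u' v' x1' x2' k1' n1' k2' n2'
    assume a: "immediate_precedents u' v' w"
      "fractional_markov_label (horoball u') x1'" "fractional_markov_label (horoball v') x2'"
      "quotient_of x1' = (k1', n1')" "quotient_of x2' = (k2', n2')"
      "x' = (of_int (k1' * n1' + k2' * n2') / of_int (k2' * n1' - k1' * n2')) /
         of_int (3 * n1' * n2' - (k2' * n1' - k1' * n2'))"
    have "u' = u" "v' = v" using immediate_precedents_unique[OF a(1) uvw(4)] by auto
    then have "x1' = x1" "x2' = x2" using a(2,3) 3(6,7) uvw by auto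
    then show ?case using a(4-6) 3(4,5) by simp
  qed auto
qed (use fractional_markov_label_inv in \<open>blast+\<close>)

lemma lambda_FM_eq: "fractional_markov_label H x \<Longrightarrow> lambda_FM H = x"
  unfolding lambda_FM_def using fractional_markov_label_unique by blast

section \<open>The tree of edges\<close>

text \<open>The labels of an admissible pair of neighbours; \<open>k2 * n1 - k1 * n2\<close> is the Markov label of
  the common neighbour that precedes them, and \<open>3 * n1 * n2 - (k2 * n1 - k1 * n2)\<close> that of the
  mediant, which is to exceed both.\<close>
definition markov_edge :: "int \<Rightarrow> int \<Rightarrow> int \<Rightarrow> int \<Rightarrow> bool" where
  "markov_edge k1 n1 k2 n2 \<longleftrightarrow>
     0 < n1 \<and> 0 < n2 \<and> 0 \<le> k1 \<and> 2 * k2 \<le> n2 \<and> 0 < k2 * n1 - k1 * n2 \<and>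
     n1\<^sup>2 + n2\<^sup>2 + (k2 * n1 - k1 * n2)\<^sup>2 = 3 * n1 * n2 * (k2 * n1 - k1 * n2) \<and>
     (k2 * n1 - k1 * n2) dvd (k1 * n1 + k2 * n2) \<and>
     n1 < 3 * n1 * n2 - (k2 * n1 - k1 * n2) \<and> n2 < 3 * n1 * n2 - (k2 * n1 - k1 * n2) \<and>
     coprime k1 n1 \<and> coprime k2 n2 \<and> coprime n1 n2"

text \<open>The heart of the matter. The two determinant identities come out after multiplication by \<open>d\<close>,
  because the Markov equation says \<open>n * d = n1\<^sup>2 + n2\<^sup>2\<close>. They show that passing to a half of the edge
  replaces \<open>d\<close> by the label of the vertex left behind, so that both labelling rules agree on the
  denominator, and modulo \<open>n\<close> they say that multiplication by \<open>k\<close> takes \<open>n1\<close> to \<open>n2\<close> and \<open>n2\<close> to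
  \<open>- n1\<close>.\<close>
lemma markov_edge_mediant:
  assumes e: "markov_edge k1 n1 k2 n2"
  defines "d \<equiv> k2 * n1 - k1 * n2"
  defines "k \<equiv> (k1 * n1 + k2 * n2) div d" and "n \<equiv> 3 * n1 * n2 - d"
  shows "k * d = k1 * n1 + k2 * n2"
    and "k * n1 - k1 * n = n2" and "k2 * n - k * n2 = n1"
    and "n1\<^sup>2 + n\<^sup>2 + n2\<^sup>2 = 3 * n1 * n * n2"
    and "0 < k" and "2 * k < n"
    and "markov_edge k1 n1 k n" and "markov_edge k n k2 n2"
proof -
  have pos: "n1 > 0" "n2 > 0" "d > 0" "k1 \<ge> 0" and k2: "2 * k2 \<le> n2"
    and M: "n1\<^sup>2 + n2\<^sup>2 + d\<^sup>2 = 3 * n1 * n2 * d" and dv: "d dvd k1 * n1 + k2 * n2"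
    and less: "n1 < n" "n2 < n" and cop: "coprime n1 n2" "coprime k1 n1" "coprime k2 n2"
    using e by (simp_all add: markov_edge_def d_def n_def)
  show kd: "k * d = k1 * n1 + k2 * n2" using dv by (simp add: k_def)
  have nd: "n * d = n1\<^sup>2 + n2\<^sup>2"
    using M by (simp add: n_def algebra_simps power2_eq_square)
  have "d * (k * n1 - k1 * n) = (k * d) * n1 - k1 * (n * d)" by (simp add: algebra_simps)
  also have "\<dots> = d * n2" unfolding kd nd by (simp add: d_def algebra_simps power2_eq_square)
  finally show r1: "k * n1 - k1 * n = n2" using pos by simp
  have "d * (k2 * n - k * n2) = k2 * (n * d) - (k * d) * n2" by (simp add: algebra_simps)
  also have "\<dots> = d * n1" unfolding kd nd by (simp add: d_def algebra_simps power2_eq_square)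
  finally show r2: "k2 * n - k * n2 = n1" using pos by simp
  have "n1\<^sup>2 + n\<^sup>2 + n2\<^sup>2 = n * (n + d)"
    using nd by (simp add: algebra_simps power2_eq_square)
  also have "\<dots> = 3 * n1 * n * n2" by (simp add: n_def)
  finally show M': "n1\<^sup>2 + n\<^sup>2 + n2\<^sup>2 = 3 * n1 * n * n2" .
  have "k2 * n1 > 0" using pos by (simp add: d_def) (smt (verit) mult_nonneg_nonneg)
  then have "k2 > 0" using pos by (simp add: zero_less_mult_iff)
  then have "k * d > 0" unfolding kd using pos by (simp add: add_nonneg_pos)
  then show kpos: "k > 0" using pos by (simp add: zero_less_mult_iff)
  have "2 * k * n2 = 2 * k2 * n - 2 * n1" using r2 by simp
  also have "\<dots> < 2 * k2 * n" using pos by simp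
  also have "\<dots> \<le> n2 * n" using k2 less pos by (intro mult_right_mono) auto
  finally show k_half: "2 * k < n" using pos by (simp add: mult.commute[of _ n2])
  have npos: "n > 0" using less pos by simp
  have c1: "coprime n1 n"
  proof (rule coprimeI)
    fix g assume "g dvd n1" "g dvd n"
    moreover from this have "g dvd n2" using r1 by (metis dvd_diff dvd_mult)
    ultimately show "is_unit g" using cop(1) coprime_common_divisor by blast
  qed
  have c2: "coprime n n2"
  proof (rule coprimeI)
    fix g assume "g dvd n" "g dvd n2"
    moreover from this have "g dvd n1" using r2 by (metis dvd_diff dvd_mult)
    ultimately show "is_unit g" using cop(1) coprime_common_divisor by blast
  qed
  have c3: "coprime k n"
  proof (rule coprimeI)
    fix g assume "g dvd k" "g dvd n"
    moreover from this have "g dvd n2" using r1 by (metis dvd_diff dvd_mult dvd_mult2)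
    ultimately show "is_unit g" using c2 coprime_common_divisor by blast
  qed
  have "n1 * (k1 * n1 + k * n) = k1 * n1\<^sup>2 + n * (k * n1)"
    by (simp add: algebra_simps power2_eq_square)
  also have "k * n1 = n2 + k1 * n" using r1 by simp
  also have "k1 * n1\<^sup>2 + n * (n2 + k1 * n) = k1 * (n1\<^sup>2 + n\<^sup>2) + n * n2"
    by (simp add: algebra_simps power2_eq_square)
  also have "n1\<^sup>2 + n\<^sup>2 = n2 * (3 * n1 * n - n2)"
    using M' by (simp add: algebra_simps power2_eq_square)
  finally have "n2 dvd n1 * (k1 * n1 + k * n)" by simp
  then have dv1: "n2 dvd k1 * n1 + k * n"
    using cop(1) by (simp add: coprime_dvd_mult_right_iff coprime_commute)
  have "n2 * (k * n + k2 * n2) = n * (k * n2) + k2 * n2\<^sup>2"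
    by (simp add: algebra_simps power2_eq_square)
  also have "k * n2 = k2 * n - n1" using r2 by simp
  also have "n * (k2 * n - n1) + k2 * n2\<^sup>2 = k2 * (n\<^sup>2 + n2\<^sup>2) - n * n1"
    by (simp add: algebra_simps power2_eq_square)
  also have "n\<^sup>2 + n2\<^sup>2 = n1 * (3 * n * n2 - n1)"
    using M' by (simp add: algebra_simps power2_eq_square)
  finally have "n1 dvd n2 * (k * n + k2 * n2)" by simp
  then have dv2: "n1 dvd k * n + k2 * n2"
    using cop(1) by (simp add: coprime_dvd_mult_right_iff)
  have grow: "n < 3 * n1 * n - n2" "n < 3 * n * n2 - n1"
  proof -
    have "n \<le> n1 * n" "n \<le> n * n2" using pos npos by simp_all
    then show "n < 3 * n1 * n - n2" "n < 3 * n * n2 - n1" using less npos by linarith+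
  qed
  show "markov_edge k1 n1 k n"
    unfolding markov_edge_def r1 using pos npos k_half M' dv1 grow less cop c1 c3 by auto
  show "markov_edge k n k2 n2"
    unfolding markov_edge_def r2 using pos npos kpos k2 M' dv2 grow less cop c2 c3
    by (auto simp: algebra_simps)
qed

text \<open>A vertex \<open>(p, q, k, n)\<close> carries the fraction \<open>p / q\<close> and the fractional Markov label
  \<open>k / n\<close>.\<close>
type_synonym vertex = "int \<times> int \<times> int \<times> int"

fun mediant :: "vertex \<times> vertex \<Rightarrow> vertex" where
  "mediant ((p1, q1, k1, n1), (p2, q2, k2, n2)) =
     (p1 + p2, q1 + q2, (k1 * n1 + k2 * n2) div (k2 * n1 - k1 * n2),
      3 * n1 * n2 - (k2 * n1 - k1 * n2))"

text \<open>The half of an edge on the side of its first (\<open>True\<close>) or second (\<open>False\<close>) end, so that a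
  list of Booleans describes a walk down the tree.\<close>
fun half :: "bool \<Rightarrow> vertex \<times> vertex \<Rightarrow> vertex \<times> vertex" where
  "half True (x, y) = (x, mediant (x, y))"
| "half False (x, y) = (mediant (x, y), y)"

definition unit_edge :: "vertex \<times> vertex" where
  "unit_edge = ((0, 1, 0, 1), (1, 1, 1, 2))"

fun good_edge :: "vertex \<times> vertex \<Rightarrow> bool" where
  "good_edge ((p1, q1, k1, n1), (p2, q2, k2, n2)) \<longleftrightarrow>
     p2 * q1 - p1 * q2 = 1 \<and> 0 \<le> p1 \<and> p2 \<le> q2 \<and> 0 < q1 \<and> 0 < q2 \<and> markov_edge k1 n1 k2 n2"

lemma good_unit_edge: "good_edge unit_edge"
  by (simp add: unit_edge_def markov_edge_def)

lemma good_half: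
  assumes "good_edge e"
  shows "good_edge (half b e)"
proof -
  obtain p1 q1 k1 n1 p2 q2 k2 n2 where e: "e = ((p1, q1, k1, n1), (p2, q2, k2, n2))"
    by (metis prod.collapse)
  have g: "p2 * q1 - p1 * q2 = 1" "0 \<le> p1" "p2 \<le> q2" "0 < q1" "0 < q2" "markov_edge k1 n1 k2 n2"
    using assms by (simp_all add: e)
  have "p1 + p2 \<le> q1 + q2"
  proof -
    have "p1 * q2 < q1 * q2"
    proof -
      have "p1 * q2 < p2 * q1" using g(1) by simp
      also have "\<dots> \<le> q2 * q1" using g(3,4) by (intro mult_right_mono) auto
      finally show ?thesis by (simp add: mult.commute)
    qed
    then have "p1 < q1" using g(5) by simp
    then show ?thesis using g(3) by simp
  qed
  moreover have "0 \<le> p1 + p2"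
  proof -
    have "p2 * q1 > 0" using g(1,2,5) by (smt (verit) mult_nonneg_nonneg)
    then have "p2 > 0" using g(4) by (simp add: zero_less_mult_iff)
    then show ?thesis using g(2) by simp
  qed
  ultimately show ?thesis
    using g markov_edge_mediant(7,8)[OF g(6)] by (cases b) (auto simp: e algebra_simps)
qed

lemma good_walk: "good_edge e \<Longrightarrow> good_edge (fold half bs e)"
  by (induction bs arbitrary: e) (simp_all add: good_half)

fun fm_label :: "vertex \<Rightarrow> rat" where
  "fm_label (p, q, k, n) = of_int k / of_int n"

lemma fm_label_less_iff:
  assumes "n > 0" "n' > 0"
  shows "(of_int k / of_int n :: rat) < of_int k' / of_int n' \<longleftrightarrow> k * n' < k' * n"
proof -
  have "(of_int k / of_int n :: rat) < of_int k' / of_int n' \<longleftrightarrow> (of_int (k * n') :: rat) < of_int (k' * n)"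
    using assms by (simp add: field_simps)
  then show ?thesis by (simp only: of_int_less_iff)
qed

lemma fm_label_mediant_between:
  assumes "good_edge (x, y)"
  shows "fm_label x < fm_label (mediant (x, y))" "fm_label (mediant (x, y)) < fm_label y"
proof -
  obtain p1 q1 k1 n1 p2 q2 k2 n2 where e: "x = (p1, q1, k1, n1)" "y = (p2, q2, k2, n2)"
    by (metis prod.collapse)
  have g: "markov_edge k1 n1 k2 n2" using assms by (simp add: e)
  then have "n1 > 0" "n2 > 0" "3 * n1 * n2 - (k2 * n1 - k1 * n2) > 0"
    by (auto simp: markov_edge_def)
  then show "fm_label x < fm_label (mediant (x, y))" "fm_label (mediant (x, y)) < fm_label y"
   
      using markov_edge_mediant(2,3)[OF g] by (simp_all only: e mediant.simps fm_label.simps fm_label_less_iff)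
qed

text \<open>A half of an edge keeps one end and moves the other to the mediant, so the intervals of labels
  are nested along a walk.\<close>
lemma fm_label_walk_between:
  assumes "good_edge (x, y)"
  shows "fm_label x < fm_label (mediant (fold half bs (x, y)))
    \<and> fm_label (mediant (fold half bs (x, y))) < fm_label y"
  using assms
proof (induction bs arbitrary: x y)
  case Nil
  then show ?case using fm_label_mediant_between by simp
next
  case (Cons b bs)
  have g: "good_edge (half b (x, y))" using Cons.prems good_half by blast
  show ?case
  proof (cases b)
    case True
    then show ?thesis
      using g Cons.IH[of x "mediant (x, y)"] fm_label_mediant_between(2)[OF Cons.prems] by simp
  next
    case False
    then show ?thesis
      using g Cons.IH[of "mediant (x, y)" y] fm_label_mediant_between(1)[OF Cons.prems] by simp
  qed
qed

text \<open>Two different walks separate at some edge, and the mediant of that edge then lies strictly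
  between their labels or coincides with exactly one of them.\<close>
lemma fm_label_walk_inj:
  assumes "good_edge e"
    and "fm_label (mediant (fold half bs e)) = fm_label (mediant (fold half cs e))"
  shows "bs = cs"
  using assms
proof (induction bs arbitrary: e cs)
  case Nil
  obtain x y where e: "e = (x, y)" by (metis prod.collapse)
  show ?case
  proof (cases cs)
    case (Cons c cs')
    have "good_edge (half c e)" using Nil.prems(1) good_half by blast
    then have "fm_label (mediant e) \<noteq> fm_label (mediant (fold half cs' (half c e)))"
      using fm_label_walk_between[of x "mediant e" cs'] fm_label_walk_between[of "mediant e" y cs']
      by (cases c) (auto simp: e simp del: mediant.simps)
    with Nil.prems(2) Cons show ?thesis by simp
  qed simp
next
  case (Cons b bs)
  obtain x y where e: "e = (x, y)" by (metis prod.collapse)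
  have gb: "good_edge (half c e)" for c using Cons.prems(1) good_half by blast
  have side: "fm_label (mediant (fold half ds (half True e))) < fm_label (mediant e)"
    "fm_label (mediant e) < fm_label (mediant (fold half ds (half False e)))" for ds
    using fm_label_walk_between[of x "mediant e" ds] fm_label_walk_between[of "mediant e" y ds]
      gb[of True] gb[of False] by (auto simp: e simp del: mediant.simps)
  show ?case
  proof (cases cs)
    case Nil
    then show ?thesis using Cons.prems(2) side[of bs] by (cases b) auto
  next
    case (Cons c cs')
    then have eq: "fm_label (mediant (fold half bs (half b e)))
        = fm_label (mediant (fold half cs' (half c e)))" using Cons.prems(2) by simp
    then have "b = c" using side[of bs] side[of cs'] by (cases b; cases c) auto
    then show ?thesis using Cons.IH[OF gb] eq Cons by simp
  qed
qed

text \<open>Subtracting the vector with the smaller denominator from the other one leads back to the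
  edge from 0 to 1.\<close>
lemma farey_edge_reached:
  assumes "p2 * q1 - p1 * q2 = 1" "0 \<le> p1" "p2 \<le> q2" "0 < q1" "0 < q2"
  obtains bs k1 n1 k2 n2 where "fold half bs unit_edge = ((p1, q1, k1, n1), (p2, q2, k2, n2))"
proof -
  have "\<exists>bs k1 n1 k2 n2. fold half bs unit_edge = ((p1, q1, k1, n1), (p2, q2, k2, n2))"
    using assms
  proof (induction "nat (q1 + q2)" arbitrary: p1 q1 p2 q2 rule: less_induct)
    case less
    have p2: "p2 > 0"
    proof -
      have "p2 * q1 > 0" using less.prems by (smt (verit) mult_nonneg_nonneg)
      then show ?thesis using less.prems(4) by (simp add: zero_less_mult_iff)
    qed
    have p1: "p1 < q1"
    proof -
      have "p1 * q2 < p2 * q1" using less.prems(1) by simp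
      also have "\<dots> \<le> q2 * q1" using less.prems by (intro mult_right_mono) auto
      finally show ?thesis using less.prems(5) by (simp add: mult.commute[of _ q2])
    qed
    consider "q1 = q2" | "q1 > q2" | "q1 < q2" by linarith
    then show ?case
    proof cases
      case 1
      then have "(p2 - p1) * q2 = 1" using less.prems(1) by (simp add: algebra_simps)
      then have "q2 = 1" using less.prems(5) by (metis pos_zmult_eq_1_iff mult.commute)
      then have "q1 = 1" "q2 = 1" "p1 = 0" "p2 = 1" using 1 less.prems p1 p2 by auto
      then show ?thesis by (intro exI[of _ "[]"]) (simp add: unit_edge_def)
    next
      case 2
      have "0 \<le> p1 - p2"
      proof (rule ccontr)
        assume "\<not> ?thesis"
        then have "p1 + 1 \<le> p2" by simp
        have "p2 * q1 - p1 * q2 \<ge> p2 * (q2 + 1) - p1 * q2"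
          using 2 p2 by (simp add: mult_left_mono)
        moreover have "p2 * (q2 + 1) - p1 * q2 = (p2 - p1) * q2 + p2" by (simp add: algebra_simps)
        moreover have "(p2 - p1) * q2 > 0" using \<open>p1 + 1 \<le> p2\<close> less.prems(5) by simp
        ultimately show False using less.prems(1) p2 by linarith
      qed
      then obtain bs k1 n1 k2 n2 where
        "fold half bs unit_edge = ((p1 - p2, q1 - q2, k1, n1), (p2, q2, k2, n2))"
        using less.hyps[of "q1 - q2" q2 p2 "p1 - p2"] less.prems 2
        by (auto simp: algebra_simps)
      then have "fold half (bs @ [False]) unit_edge =
        ((p1, q1, (k1 * n1 + k2 * n2) div (k2 * n1 - k1 * n2), 3 * n1 * n2 - (k2 * n1 - k1 * n2)), (p2, q2, k2, n2))"
        by simp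
      then show ?thesis by blast
    next
      case 3
      have "p2 - p1 \<le> q2 - q1"
      proof (rule ccontr)
        assume "\<not> ?thesis"
        then have a: "(q1 - p1) - (q2 - p2) \<ge> 1" by simp
        have "p2 * q1 - p1 * q2 = (q1 - p1) * q2 - (q2 - p2) * q1" by (simp add: algebra_simps)
        also have "\<dots> = ((q1 - p1) - (q2 - p2)) * q1 + (q1 - p1) * (q2 - q1)"
          by (simp add: algebra_simps)
        also have "\<dots> \<ge> q1 + 1"
        proof -
          have "1 * q1 \<le> ((q1 - p1) - (q2 - p2)) * q1"
            using a less.prems(4) by (intro mult_right_mono) auto
          moreover have "0 < (q1 - p1) * (q2 - q1)" using p1 3 by simp
          ultimately show ?thesis by linarith
        qed
        finally show False using less.prems(1,4) by linarith
      qed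
      then obtain bs k1 n1 k2 n2 where
        "fold half bs unit_edge = ((p1, q1, k1, n1), (p2 - p1, q2 - q1, k2, n2))"
        using less.hyps[of q1 "q2 - q1" "p2 - p1" p1] less.prems 3
        by (auto simp: algebra_simps)
      then have "fold half (bs @ [True]) unit_edge =
        ((p1, q1, k1, n1), (p2, q2, (k1 * n1 + k2 * n2) div (k2 * n1 - k1 * n2), 3 * n1 * n2 - (k2 * n1 - k1 * n2)))"
        by simp
      then show ?thesis by blast
    qed
  qed
  with that show ?thesis by blast
qed

section \<open>Markov triples with a fixed entry\<close>

text \<open>The polynomial \<open>(z - t) * (d - t)\<close>, whose roots are the two completions \<open>z\<close> and \<open>d\<close> of \<open>x, y\<close>, is
  not positive at \<open>t = y\<close>.\<close>
lemma markov_vieta_root: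
  fixes x y z :: int
  assumes pos: "0 < x" "0 < y" "0 < z" and M: "x\<^sup>2 + y\<^sup>2 + z\<^sup>2 = 3 * x * y * z"
    and le: "x \<le> y" "y \<le> z" and "z > 1"
  defines "d \<equiv> 3 * x * y - z"
  shows "0 < d" "d \<le> y" "y < z" "x\<^sup>2 + y\<^sup>2 + d\<^sup>2 = 3 * x * y * d"
proof -
  have zd: "z * d = x\<^sup>2 + y\<^sup>2"
    using M by (simp add: d_def algebra_simps power2_eq_square)
  have "x\<^sup>2 + y\<^sup>2 > 0" using pos by (simp add: add_pos_pos)
  then show "0 < d" using zd pos by (metis zero_less_mult_pos)
  have "x\<^sup>2 + y\<^sup>2 + d\<^sup>2 = d * (z + d)"
    using zd by (simp add: algebra_simps power2_eq_square)
  also have "\<dots> = 3 * x * y * d" by (simp add: d_def)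
  finally show "x\<^sup>2 + y\<^sup>2 + d\<^sup>2 = 3 * x * y * d" .
  have "(z - y) * (d - y) = z * d - y * (z + d) + y\<^sup>2"
    by (simp add: algebra_simps power2_eq_square)
  also have "\<dots> = x\<^sup>2 + 2 * y\<^sup>2 - 3 * x * y\<^sup>2"
    unfolding zd by (simp add: d_def power2_eq_square)
  finally have prod: "(z - y) * (d - y) = x\<^sup>2 + 2 * y\<^sup>2 - 3 * x * y\<^sup>2" .
  have x2: "x\<^sup>2 \<le> y\<^sup>2" using pos le by (intro power_mono) auto
  have y2: "y\<^sup>2 \<le> x * y\<^sup>2" using pos by simp
  show yz: "y < z"
  proof (rule ccontr)
    assume "\<not> y < z"
    then have "y = z" using le by simp
    then have eq: "x\<^sup>2 + 2 * y\<^sup>2 = 3 * x * y\<^sup>2" using prod by simp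
    have "x = 1"
    proof (rule ccontr)
      assume "x \<noteq> 1"
      then have "2 * y\<^sup>2 \<le> x * y\<^sup>2" using pos by (intro mult_right_mono) auto
      moreover have "y\<^sup>2 > 0" using pos by simp
      ultimately show False using eq x2 by linarith
    qed
    then have "y\<^sup>2 = 1" using eq by simp
    then show False using \<open>y = z\<close> \<open>z > 1\<close> by (simp add: power2_eq_1_iff)
  qed
  have "(z - y) * (d - y) \<le> 0" using prod x2 y2 by linarith
  then show "d \<le> y" using yz by (simp add: mult_le_0_iff)
qed

lemma markov_vieta_root_max:
  fixes x y z :: int
  assumes "0 < x" "0 < y" "0 < z" "x\<^sup>2 + y\<^sup>2 + z\<^sup>2 = 3 * x * y * z" "x \<le> z" "y \<le> z" "z > 1"
  defines "d \<equiv> 3 * x * y - z"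
  shows "0 < d" "d \<le> max x y" "max x y < z" "x\<^sup>2 + y\<^sup>2 + d\<^sup>2 = 3 * x * y * d"
proof -
  have "0 < d \<and> d \<le> max x y \<and> max x y < z \<and> x\<^sup>2 + y\<^sup>2 + d\<^sup>2 = 3 * x * y * d"
  proof (cases "x \<le> y")
    case True
    then show ?thesis using markov_vieta_root[of x y z] assms by simp
  next
    case False
    have M: "y\<^sup>2 + x\<^sup>2 + z\<^sup>2 = 3 * y * x * z"
      using assms(4) by (simp add: algebra_simps)
    have d: "d = 3 * y * x - z" by (simp add: d_def)
    show ?thesis using False markov_vieta_root[OF assms(2,1,3) M _ assms(5,7), folded d]
      by (simp add: algebra_simps)
  qed
  then show "0 < d" "d \<le> max x y" "max x y < z" "x\<^sup>2 + y\<^sup>2 + d\<^sup>2 = 3 * x * y * d" by auto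
qed

text \<open>Classical descent: replacing the largest entry by the other root leads to a triple with
  smaller maximum, down to \<open>(1, 5, 2)\<close>, the triple of the edge from 0 to 1. Going back up, the step is a
  half of the edge found for the smaller triple. The triples \<open>(1, 1, 1)\<close> and \<open>(1, 1, 2)\<close> lie above the
  root, hence the bound on \<open>z\<close>.\<close>
lemma markov_triple_reached:
  fixes x y z :: int
  assumes "0 < x" "0 < y" "0 < z" "x\<^sup>2 + y\<^sup>2 + z\<^sup>2 = 3 * x * y * z" "x \<le> y" "y \<le> z" "2 < z"
  shows "\<exists>bs p1 q1 k1 n1 p2 q2 k2 n2. fold half bs unit_edge = ((p1, q1, k1, n1), (p2, q2, k2, n2)) \<and>
     (n1 = x \<and> n2 = y \<or> n1 = y \<and> n2 = x) \<and> 3 * n1 * n2 - (k2 * n1 - k1 * n2) = z"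
  using assms
proof (induction "nat z" arbitrary: x y z rule: less_induct)
  case less
  define d where "d = 3 * x * y - z"
  have "z > 1" using less.prems by simp
  note v = markov_vieta_root[OF less.prems(1-6) this, folded d_def]
  show ?case
  proof (cases "y \<le> 2")
    case True
    have xy: "x = 1 \<and> y = 1 \<or> x = 1 \<and> y = 2 \<or> x = 2 \<and> y = 2"
      using True less.prems by auto
    moreover have "d = 1 \<or> d = 2" using True v(1,2) by auto
    ultimately have "x = 1 \<and> y = 2 \<and> z = 5" using v(4) less.prems(7) d_def by auto
    then show ?thesis by (intro exI[of _ "[]"]) (simp add: unit_edge_def)
  next
    case False
    have "\<exists>bs p1 q1 k1 n1 p2 q2 k2 n2. fold half bs unit_edge = ((p1, q1, k1, n1), (p2, q2, k2, n2)) \<and>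
      (n1 = min x d \<and> n2 = max x d \<or> n1 = max x d \<and> n2 = min x d) \<and> 3 * n1 * n2 - (k2 * n1 - k1 * n2) = y"
      by (rule less.hyps) (use False v less.prems in \<open>auto simp: min_def max_def algebra_simps\<close>)
    then obtain bs p1 q1 k1 n1 p2 q2 k2 n2 where
      e: "fold half bs unit_edge = ((p1, q1, k1, n1), (p2, q2, k2, n2))"
      and n: "n1 = x \<and> n2 = d \<or> n1 = d \<and> n2 = x"
      and y: "3 * n1 * n2 - (k2 * n1 - k1 * n2) = y"
      by (metis min_def max_def)
    have g: "markov_edge k1 n1 k2 n2" using good_walk[OF good_unit_edge, of bs] e by simp
    define k where "k = (k1 * n1 + k2 * n2) div (k2 * n1 - k1 * n2)"
    note m = markov_edge_mediant(2,3)[OF g, folded k_def, unfolded y]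
    show ?thesis
    proof (cases "n1 = x \<and> n2 = d")
      case True
      have "fold half (bs @ [True]) unit_edge = ((p1, q1, k1, n1), (p1 + p2, q1 + q2, k, y))"
        using e y by (simp add: k_def)
      moreover have "3 * n1 * y - (k * n1 - k1 * y) = z" unfolding m(1)
        using True by (simp add: d_def)
      ultimately show ?thesis using True by blast
    next
      case False
      have "fold half (bs @ [False]) unit_edge = ((p1 + p2, q1 + q2, k, y), (p2, q2, k2, n2))"
        using e y by (simp add: k_def)
      moreover have "3 * y * n2 - (k2 * y - k * n2) = z" unfolding m(2)
        using False n by (auto simp: d_def)
      ultimately show ?thesis using False n by blast
    qed
  qed
qed

text \<open>Repeated exchange of the older of two entries in a Markov triple whose third entry is
  \<open>n\<close>.\<close>
fun chain :: "int \<Rightarrow> int \<Rightarrow> int \<Rightarrow> nat \<Rightarrow> int" where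
  "chain n x y 0 = x"
| "chain n x y (Suc 0) = y"
| "chain n x y (Suc (Suc i)) = 3 * n * chain n x y (Suc i) - chain n x y i"

text \<open>The chains in both directions from \<open>(n1, n2)\<close> together list the consecutive pairs, in the same
  orientation, of one sequence indexed by the integers.\<close>
definition on_chains :: "int \<Rightarrow> int \<Rightarrow> int \<Rightarrow> int \<Rightarrow> int \<Rightarrow> bool" where
  "on_chains n n1 n2 y c \<longleftrightarrow>
     (\<exists>i. y = chain n n1 n2 i \<and> c = chain n n1 n2 (Suc i) \<or>
          y = chain n n2 n1 (Suc i) \<and> c = chain n n2 n1 i)"

lemma on_chains_swap: "on_chains n n1 n2 y c \<longleftrightarrow> on_chains n n2 n1 c y"
  by (auto simp: on_chains_def)

text \<open>Going back along one chain past its start continues with the other one.\<close>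
lemma on_chains_step:
  assumes "on_chains n n1 n2 d y"
  shows "on_chains n n1 n2 y (3 * n * y - d)"
proof -
  from assms obtain i where i: "d = chain n n1 n2 i \<and> y = chain n n1 n2 (Suc i) \<or>
          d = chain n n2 n1 (Suc i) \<and> y = chain n n2 n1 i" by (auto simp: on_chains_def)
  then show ?thesis
  proof
    assume "d = chain n n1 n2 i \<and> y = chain n n1 n2 (Suc i)"
    then show ?thesis unfolding on_chains_def by (intro exI[of _ "Suc i"]) simp
  next
    assume a: "d = chain n n2 n1 (Suc i) \<and> y = chain n n2 n1 i"
    show ?thesis
    proof (cases i)
      case 0
      then show ?thesis using a unfolding on_chains_def by (intro exI[of _ "Suc 0"]) simp
    next
      case (Suc j)
      then show ?thesis using a unfolding on_chains_def by (intro exI[of _ j]) simp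
    qed
  qed
qed

lemma on_chains_step':
  assumes "on_chains n n1 n2 c d"
  shows "on_chains n n1 n2 (3 * n * c - d) c"
  using on_chains_step[of n n2 n1 d c] assms on_chains_swap by blast

text \<open>A Markov number \<open>n\<close> might be the maximum of several triples, but the residue of \<open>- y / c\<close>
  modulo \<open>n\<close> singles out one. The triple belongs to an edge of the tree whose mediant label has
  numerator congruent to \<open>k\<close> or, if \<open>y\<close> and \<open>c\<close> occur in the opposite order, to \<open>- k\<close>. Numerators of
  mediant labels lie strictly between 0 and \<open>n / 2\<close>: this excludes the second case and turns the
  congruence of the first into equality, and equal labels mean equal edges.\<close>
lemma maximal_triple_unique:
  assumes e: "fold half bs unit_edge = ((p1, q1, k1, n1), (p2, q2, k2, n2))"
    and k: "k = (k1 * n1 + k2 * n2) div (k2 * n1 - k1 * n2)"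
    and n: "n = 3 * n1 * n2 - (k2 * n1 - k1 * n2)"
    and yc: "0 < y" "0 < c" "y \<le> n" "c \<le> n" and M: "y\<^sup>2 + c\<^sup>2 + n\<^sup>2 = 3 * y * c * n"
    and dv: "n dvd y + k * c" and "2 < n"
  shows "y = n1" "c = n2"
proof -
  have "\<exists>cs P1 Q1 K1 N1 P2 Q2 K2 N2. fold half cs unit_edge = ((P1, Q1, K1, N1), (P2, Q2, K2, N2)) \<and>
     (N1 = y \<and> N2 = c \<or> N1 = c \<and> N2 = y) \<and> 3 * N1 * N2 - (K2 * N1 - K1 * N2) = n"
  proof (cases "y \<le> c")
    case True
    then show ?thesis using markov_triple_reached[of y c n] yc M \<open>2 < n\<close> by simp
  next
    case False
    then have "\<exists>cs P1 Q1 K1 N1 P2 Q2 K2 N2. fold half cs unit_edge = ((P1, Q1, K1, N1), (P2, Q2, K2, N2)) \<and>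
     (N1 = c \<and> N2 = y \<or> N1 = y \<and> N2 = c) \<and> 3 * N1 * N2 - (K2 * N1 - K1 * N2) = n"
      using yc M \<open>2 < n\<close> by (intro markov_triple_reached) (auto simp: algebra_simps)
    then show ?thesis by (simp only: disj_commute)
  qed
  then obtain cs P1 Q1 K1 N1 P2 Q2 K2 N2 where
    e': "fold half cs unit_edge = ((P1, Q1, K1, N1), (P2, Q2, K2, N2))" and
    N': "N1 = y \<and> N2 = c \<or> N1 = c \<and> N2 = y" and
    n': "3 * N1 * N2 - (K2 * N1 - K1 * N2) = n"
    by blast
  have g: "markov_edge k1 n1 k2 n2" "markov_edge K1 N1 K2 N2"
    using good_walk[OF good_unit_edge] e e' by (metis good_edge.simps)+
  define K where "K = (K1 * N1 + K2 * N2) div (K2 * N1 - K1 * N2)"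
  note m = markov_edge_mediant[OF g(1), folded k n]
  note m' = markov_edge_mediant[OF g(2), folded K_def, unfolded n']
  have cop: "coprime N1 n" "coprime N2 n"
    using m'(7,8) by (auto simp: markov_edge_def coprime_commute)
  have "N1 + K * N2 = K2 * n" "N2 - K * N1 = - (K1 * n)" using m'(2,3) by simp_all
  then have dv1: "n dvd N1 + K * N2" and dv2: "n dvd N2 - K * N1" by simp_all
  have "N1 = y \<and> N2 = c"
  proof (rule ccontr)
    assume "\<not> ?thesis"
    then have sw: "N1 = c" "N2 = y" using N' by auto
    have "n dvd (y + k * c) - (N2 - K * N1)" using dv dv2 by (rule dvd_diff)
    then have "n dvd (k + K) * N1" by (simp add: sw algebra_simps)
    then have "n dvd k + K" using cop(1) by (simp add: coprime_dvd_mult_left_iff coprime_commute)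
    then have "n \<le> k + K" using m(5) m'(5) by (simp add: zdvd_imp_le)
    then show False using m(6) m'(6) by linarith
  qed
  then have sw: "N1 = y" "N2 = c" by auto
  have "n dvd (y + k * c) - (N1 + K * N2)" using dv dv1 by (rule dvd_diff)
  then have "n dvd (k - K) * N2" by (simp add: sw algebra_simps)
  then have kK: "n dvd k - K" using cop(2) by (simp add: coprime_dvd_mult_left_iff coprime_commute)
  have "k = K"
  proof (rule ccontr)
    assume "k \<noteq> K"
    then have "n \<le> \<bar>k - K\<bar>" using dvd_imp_le_int[OF _ kK] by simp
    then show False using m(5,6) m'(5,6) by linarith
  qed
  then have "fm_label (mediant (fold half bs unit_edge)) = fm_label (mediant (fold half cs unit_edge))"
    using e e' k n n' K_def by simp
  then have "bs = cs" by (rule fm_label_walk_inj[OF good_unit_edge])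
  then show "y = n1" "c = n2" using e e' sw by auto
qed

text \<open>Exchanging the largest of \<open>y\<close>, \<open>c\<close> for the other root keeps the congruence, because \<open>k\<^sup>2\<close> is
  \<open>-1\<close> modulo \<open>n\<close>, and moves along the chain. The descent stops when \<open>n\<close> is the maximum, where the triple
  is known.\<close>
lemma markov_triples_on_chains:
  assumes e: "fold half bs unit_edge = ((p1, q1, k1, n1), (p2, q2, k2, n2))"
    and k: "k = (k1 * n1 + k2 * n2) div (k2 * n1 - k1 * n2)"
    and n: "n = 3 * n1 * n2 - (k2 * n1 - k1 * n2)"
    and "0 < y" "0 < c" "y\<^sup>2 + c\<^sup>2 + n\<^sup>2 = 3 * y * c * n" "n dvd y + k * c"
  shows "on_chains n n1 n2 y c"
proof -
  have g: "markov_edge k1 n1 k2 n2"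
    using good_walk[OF good_unit_edge] e by (metis good_edge.simps)
  note m = markov_edge_mediant[OF g, folded k n]
  have n2: "2 < n" using m(5,6) by linarith
  have kk: "n dvd k\<^sup>2 + 1"
  proof -
    have cop: "coprime n n1" using m(7) by (simp add: markov_edge_def coprime_commute)
    have a: "k * n1 = n2 + k1 * n" "n1 = k2 * n - k * n2" using m(2,3) by simp_all
    have "(k\<^sup>2 + 1) * n1 = k * (k * n1) + n1" by (simp add: algebra_simps power2_eq_square)
    also have "\<dots> = k * (n2 + k1 * n) + (k2 * n - k * n2)" using a by metis
    also have "\<dots> = n * (k2 + k1 * k)" by (simp add: algebra_simps)
    finally have "(k\<^sup>2 + 1) * n1 = n * (k2 + k1 * k)" .
    then have "n dvd (k\<^sup>2 + 1) * n1" by simp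
    then show ?thesis using cop by (simp add: coprime_dvd_mult_left_iff)
  qed
  have turn: "n dvd k * y - c" if "n dvd y + k * c" for y c
  proof -
    have "n dvd k * (y + k * c) - (k\<^sup>2 + 1) * c" using that kk by simp
    then show ?thesis by (simp add: algebra_simps power2_eq_square)
  qed
  from assms(4-7) show ?thesis
  proof (induction "nat (y + c)" arbitrary: y c rule: less_induct)
    case less
    consider "y \<le> n" "c \<le> n" | "c > n" "c \<ge> y" | "y > n" "y \<ge> c" by linarith
    then show ?case
    proof cases
      case 1
      then have "y = n1" "c = n2"
        using maximal_triple_unique[OF e k n less.prems(1,2) _ _ less.prems(3,4) n2] by auto
      then show ?thesis unfolding on_chains_def by (intro exI[of _ 0]) simp
    next
      case 2
      define d where "d = 3 * n * y - c"
      have v: "0 < d" "d \<le> max y n" "max y n < c" "y\<^sup>2 + n\<^sup>2 + d\<^sup>2 = 3 * y * n * d"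
      proof -
        have M: "y\<^sup>2 + n\<^sup>2 + c\<^sup>2 = 3 * y * n * c"
          using less.prems(3) by (simp add: algebra_simps)
        have d: "d = 3 * y * n - c" by (simp add: d_def)
        show "0 < d" "d \<le> max y n" "max y n < c" "y\<^sup>2 + n\<^sup>2 + d\<^sup>2 = 3 * y * n * d"
          unfolding d by (rule markov_vieta_root_max[OF _ _ _ M]; use less.prems 2 n2 in simp)+
      qed
      have "n dvd 3 * y * n + (k * y - c)" using turn[OF less.prems(4)] by (intro dvd_add) auto
      then have "n dvd d + k * y" by (simp add: d_def algebra_simps)
      moreover have "d\<^sup>2 + y\<^sup>2 + n\<^sup>2 = 3 * d * y * n"
        using v(4) by (simp add: algebra_simps)
      ultimately have "on_chains n n1 n2 d y" using less.hyps[of d y] v less.prems(1,2) by auto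
      from on_chains_step[OF this] show ?thesis by (simp add: d_def)
    next
      case 3
      define d where "d = 3 * n * c - y"
      have v: "0 < d" "d \<le> max c n" "max c n < y" "c\<^sup>2 + n\<^sup>2 + d\<^sup>2 = 3 * c * n * d"
      proof -
        have M: "c\<^sup>2 + n\<^sup>2 + y\<^sup>2 = 3 * c * n * y"
          using less.prems(3) by (simp add: algebra_simps)
        have d: "d = 3 * c * n - y" by (simp add: d_def)
        show "0 < d" "d \<le> max c n" "max c n < y" "c\<^sup>2 + n\<^sup>2 + d\<^sup>2 = 3 * c * n * d"
          unfolding d by (rule markov_vieta_root_max[OF _ _ _ M]; use less.prems 3 n2 in simp)+
      qed
      have "n dvd 3 * k * c * n - (k * y - c)" by (rule dvd_diff[OF _ turn[OF less.prems(4)]]) simp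
      then have "n dvd c + k * d" by (simp add: d_def algebra_simps)
      moreover have "c\<^sup>2 + d\<^sup>2 + n\<^sup>2 = 3 * c * d * n"
        using v(4) by (simp add: algebra_simps)
      ultimately have "on_chains n n1 n2 c d" using less.hyps[of c d] v less.prems(1,2) by auto
      from on_chains_step'[OF this] show ?thesis by (simp add: d_def)
    qed
  qed
qed

section \<open>The labels on the tree\<close>

fun vertex_farey :: "vertex \<Rightarrow> farey" where
  "vertex_farey (p, q, k, n) = Frac (Fract p q)"

fun vertex_fm_num :: "vertex \<Rightarrow> int" where
  "vertex_fm_num (p, q, k, n) = k"

fun vertex_markov :: "vertex \<Rightarrow> int" where
  "vertex_markov (p, q, k, n) = n"

abbreviation vertex_horoball :: "vertex \<Rightarrow> complex set" where
  "vertex_horoball x \<equiv> horoball (vertex_farey x)"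

lemma good_edge_num_den:
  assumes "good_edge ((p1, q1, k1, n1), (p2, q2, k2, n2))"
  shows "num (Frac (Fract p1 q1)) = p1" "den (Frac (Fract p1 q1)) = q1"
    and "num (Frac (Fract p2 q2)) = p2" "den (Frac (Fract p2 q2)) = q2"
proof -
  have g: "p2 * q1 - p1 * q2 = 1" "0 < q1" "0 < q2" using assms by simp_all
  have "coprime p1 q1"
  proof (rule coprimeI)
    fix g assume "g dvd p1" "g dvd q1"
    then have "g dvd p2 * q1 - p1 * q2" by simp
    then show "is_unit g" using g(1) by simp
  qed
  then show "num (Frac (Fract p1 q1)) = p1" "den (Frac (Fract p1 q1)) = q1"
    using num_den_Frac_Fract g by blast+
  have "coprime p2 q2"
  proof (rule coprimeI)
    fix g assume "g dvd p2" "g dvd q2"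
    then have "g dvd p2 * q1 - p1 * q2" by simp
    then show "is_unit g" using g(1) by simp
  qed
  then show "num (Frac (Fract p2 q2)) = p2" "den (Frac (Fract p2 q2)) = q2"
    using num_den_Frac_Fract g by blast+
qed

lemma good_edge_precedents:
  assumes g: "good_edge (x, y)"
  shows "immediate_precedents (vertex_farey x) (vertex_farey y) (vertex_farey (mediant (x, y)))"
    and "vertex_horoball x \<in> unit_horoballs" "vertex_horoball y \<in> unit_horoballs"
    and "vertex_horoball (mediant (x, y)) \<in> unit_horoballs"
proof -
  obtain p1 q1 k1 n1 p2 q2 k2 n2 where e: "x = (p1, q1, k1, n1)" "y = (p2, q2, k2, n2)"
    by (metis prod.collapse)
  note nd = good_edge_num_den[OF g[unfolded e]]
  have h: "good_edge (x, mediant (x, y))" "good_edge (mediant (x, y), y)"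
    using good_half[OF g, of True] good_half[OF g, of False] by simp_all
  note nd' = good_edge_num_den(3,4)[OF h(1)[unfolded e mediant.simps]]
  have d: "p2 * q1 - p1 * q2 = 1" "0 \<le> p1" "p2 \<le> q2" using g by (simp_all add: e)
  have d': "p1 + p2 \<le> q1 + q2" "0 \<le> p1 + p2" using h by (simp_all add: e)
  have d'': "p1 \<le> q1" "0 \<le> p2"
    using g h by (simp_all add: e) (smt (verit) mult_nonneg_nonneg mult_right_mono
      mult_le_cancel_right_pos mult.commute zero_le_mult_iff)+
  show "immediate_precedents (vertex_farey x) (vertex_farey y) (vertex_farey (mediant (x, y)))"
    unfolding e mediant.simps vertex_farey.simps
    by (rule farey_det_imp_precedents) (simp_all only: nd nd' d(1))
  show "vertex_horoball x \<in> unit_horoballs" "vertex_horoball y \<in> unit_horoballs"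
    "vertex_horoball (mediant (x, y)) \<in> unit_horoballs"
    unfolding e mediant.simps vertex_farey.simps horoball_unit_iff nd nd' using d d' d'' by simp_all
qed

text \<open>The vertex \<open>t\<close> is the common neighbour across the edge from the next mediant.\<close>
definition labelled_edge :: "vertex \<times> vertex \<Rightarrow> bool" where
  "labelled_edge e \<longleftrightarrow> (case e of (x, y) \<Rightarrow>
     markov_label (vertex_horoball x) (vertex_markov x) \<and>
     markov_label (vertex_horoball y) (vertex_markov y) \<and>
     fractional_markov_label (vertex_horoball x) (fm_label x) \<and>
     fractional_markov_label (vertex_horoball y) (fm_label y) \<and>
     (\<exists>t. farey_neighbors t (vertex_farey x) \<and> farey_neighbors t (vertex_farey y) \<and>
       t \<noteq> vertex_farey (mediant (x, y)) \<and>
       markov_label (horoball t)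
         (vertex_fm_num y * vertex_markov x - vertex_fm_num x * vertex_markov y)))"

lemma Fract_0_1: "Fract 0 1 = 0" and Fract_1_1: "Fract 1 1 = 1"
  by (simp_all add: Zero_rat_def One_rat_def)

text \<open>The horoball at 1 is the first that the recursions label, from \<open>0\<close>, infinity and \<open>-1\<close>.\<close>
lemma labelled_unit_edge: "labelled_edge unit_edge"
proof -
  have nd: "num (Frac 0) = 0" "den (Frac 0) = 1" "num (Frac 1) = 1" "den (Frac 1) = 1"
     "num (Frac (-1)) = -1" "den (Frac (-1)) = 1" "num Infinity = 1" "den Infinity = 0"
    by simp_all
  have prec: "immediate_precedents (Frac 0) Infinity (Frac 1)"
    by (rule farey_det_imp_precedents) (simp_all only: nd)
  have hp: "horoball_precedents (horoball (Frac 0)) (horoball Infinity) (horoball (Frac 1))"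
    using prec unfolding horoball_precedents_def by blast
  have nb: "farey_neighbors (Frac (-1)) (Frac 0)" "farey_neighbors (Frac (-1)) Infinity"
    "farey_neighbors Infinity (Frac 0)" "farey_neighbors Infinity (Frac 1)"
    unfolding farey_neighbors_def nd by simp_all
  have u: "horoball (Frac 1) \<in> unit_horoballs" unfolding horoball_unit_iff nd by simp
  have "markov_label (horoball (Frac 1)) (3 * 1 * 1 - 1)"
    by (rule markov_label.intros(4)[OF u hp _ _ _ _ markov_label.intros(2,1,3)])
      (simp_all add: packing_def horoball_eq_iff tangent_horoball_iff nb del: horoball.simps)
  then have M: "markov_label (horoball (Frac 1)) 2" by simp
  have F: "fractional_markov_label (horoball (Frac 1)) (1 / 2)"
    using fractional_markov_label.intros(3)[OF hp fractional_markov_label.intros(2,1), of 0 1 1 1]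
    by (simp del: horoball.simps)
  have v: "vertex_farey (0, 1, 0, 1) = Frac 0" "vertex_farey (1, 1, 1, 2) = Frac 1"
    "fm_label (0, 1, 0, 1) = 0" "fm_label (1, 1, 1, 2) = 1 / 2"
    "vertex_farey (mediant ((0, 1, 0, 1), (1, 1, 1, 2))) \<noteq> Infinity"
    by (simp_all add: Fract_0_1 Fract_1_1)
  have "\<exists>t. farey_neighbors t (Frac 0) \<and> farey_neighbors t (Frac 1) \<and>
      t \<noteq> vertex_farey (mediant ((0, 1, 0, 1), (1, 1, 1, 2))) \<and> markov_label (horoball t) (1 * 1 - 0 * 2)"
   
      using v(5) nb(3,4) markov_label.intros(1) by (intro exI[of _ Infinity]) (simp del: horoball.simps)
  then show ?thesis
    unfolding labelled_edge_def unit_edge_def prod.case v vertex_markov.simps vertex_fm_num.simps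
    using M F markov_label.intros(2) fractional_markov_label.intros(2) by blast
qed

lemma quotient_of_fraction:
  assumes "n > 0" "coprime k n"
  shows "quotient_of (of_int k / of_int n) = (k, n)"
  using assms by (simp add: Fract_of_int_quotient[symmetric] quotient_of_Fract normalize_stable)

text \<open>The vertex left behind takes the part of \<open>t\<close> in the half edge.\<close>
lemma labelled_half:
  assumes g: "good_edge e" and l: "labelled_edge e"
  shows "labelled_edge (half b e)"
proof -
  obtain x y where e: "e = (x, y)" by (metis prod.collapse)
  obtain p1 q1 k1 n1 p2 q2 k2 n2 where xy: "x = (p1, q1, k1, n1)" "y = (p2, q2, k2, n2)"
    by (metis prod.collapse)
  define w where "w = mediant (x, y)"
  define k where "k = (k1 * n1 + k2 * n2) div (k2 * n1 - k1 * n2)"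
  define n where "n = 3 * n1 * n2 - (k2 * n1 - k1 * n2)"
  have w: "w = (p1 + p2, q1 + q2, k, n)" by (simp add: w_def xy k_def n_def)
  have gm: "markov_edge k1 n1 k2 n2" using g by (simp add: e xy)
  note m = markov_edge_mediant[OF gm, folded k_def n_def]
  note prec = good_edge_precedents[OF g[unfolded e], folded w_def]
  have hp: "horoball_precedents (vertex_horoball x) (vertex_horoball y) (vertex_horoball w)"
    using prec(1) unfolding horoball_precedents_def by blast
  have v: "vertex_markov x = n1" "vertex_markov y = n2" "vertex_fm_num x = k1" "vertex_fm_num y = k2"
    by (simp_all add: xy)
  from l have lx: "markov_label (vertex_horoball x) n1" and ly: "markov_label (vertex_horoball y) n2"
    and fx: "fractional_markov_label (vertex_horoball x) (fm_label x)"
    and fy: "fractional_markov_label (vertex_horoball y) (fm_label y)"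
    and "\<exists>t. farey_neighbors t (vertex_farey x) \<and> farey_neighbors t (vertex_farey y) \<and> t \<noteq> vertex_farey w \<and>
      markov_label (horoball t) (k2 * n1 - k1 * n2)"
    unfolding labelled_edge_def e prod.case v w_def[symmetric] by blast+
  then obtain t where t: "farey_neighbors t (vertex_farey x)" "farey_neighbors t (vertex_farey y)"
    "t \<noteq> vertex_farey w" "markov_label (horoball t) (k2 * n1 - k1 * n2)" by blast
  have lw: "markov_label (vertex_horoball w) n"
    unfolding n_def
    by (rule markov_label.intros(4)[OF prec(4) hp _ _ _ _ lx ly t(4)])
      (use t(1-3) in \<open>simp_all only: packing_def rangeI horoball_eq_iff tangent_horoball_iff not_False_eq_True\<close>)
  have q: "quotient_of (fm_label x) = (k1, n1)" "quotient_of (fm_label y) = (k2, n2)"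
    using gm by (simp_all add: xy markov_edge_def quotient_of_fraction)
  have d: "k2 * n1 - k1 * n2 > 0" using gm by (simp add: markov_edge_def)
  have "(of_int (k1 * n1 + k2 * n2) / of_int (k2 * n1 - k1 * n2) :: rat) = of_int k"
  proof -
    have "(of_int (k2 * n1 - k1 * n2) :: rat) \<noteq> 0" using d unfolding of_int_eq_0_iff by simp
    then show ?thesis unfolding m(1)[symmetric] of_int_mult by (rule nonzero_mult_div_cancel_right)
  qed
  then have "(of_int (k1 * n1 + k2 * n2) / of_int (k2 * n1 - k1 * n2)) / of_int (3 * n1 * n2 - (k2 * n1 - k1 * n2))
     = fm_label w" by (simp only: w fm_label.simps n_def)
  then have fw: "fractional_markov_label (vertex_horoball w) (fm_label w)"
    using fractional_markov_label.intros(3)[OF hp fx fy q] by (simp only:)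
  have nb: "farey_neighbors (vertex_farey y) (vertex_farey x)" "farey_neighbors (vertex_farey y) (vertex_farey w)"
    "farey_neighbors (vertex_farey x) (vertex_farey w)" "farey_neighbors (vertex_farey x) (vertex_farey y)"
    using prec(1) farey_neighbors_commute unfolding immediate_precedents_def by blast+
  have h: "good_edge (x, w)" "good_edge (w, y)"
    using good_half[OF g, of True] good_half[OF g, of False] unfolding e half.simps w_def by blast+
  have "den (vertex_farey x) \<noteq> 0" "den (vertex_farey y) \<noteq> 0"
    unfolding den_eq_0_iff xy vertex_farey.simps by blast+
  then have denpos: "den (vertex_farey x) > 0" "den (vertex_farey y) > 0"
    using den_nonneg[of "vertex_farey x"] den_nonneg[of "vertex_farey y"] by linarith+
  note den_w = immediate_precedents_det(5)[OF prec(1)]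
  have ne1: "vertex_farey y \<noteq> vertex_farey (mediant (x, w))"
  proof
    assume "vertex_farey y = vertex_farey (mediant (x, w))"
    from arg_cong[OF this, of den] show False
     
        using immediate_precedents_det(5)[OF good_edge_precedents(1)[OF h(1)]] den_w denpos by linarith
  qed
  have ne2: "vertex_farey x \<noteq> vertex_farey (mediant (w, y))"
  proof
    assume "vertex_farey x = vertex_farey (mediant (w, y))"
    from arg_cong[OF this, of den] show False
     
        using immediate_precedents_det(5)[OF good_edge_precedents(1)[OF h(2)]] den_w denpos by linarith
  qed
  have val: "vertex_markov x = n1" "vertex_markov w = n" "vertex_markov y = n2"
    "vertex_fm_num x = k1" "vertex_fm_num w = k" "vertex_fm_num y = k2"
    by (simp_all add: xy w)
  show ?thesis
  proof (cases b)
    case True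
    have "\<exists>t. farey_neighbors t (vertex_farey x) \<and> farey_neighbors t (vertex_farey w) \<and>
        t \<noteq> vertex_farey (mediant (x, w)) \<and> markov_label (horoball t) (k * n1 - k1 * n)"
      using nb(1,2) ne1 ly unfolding m(2) by blast
    then have "labelled_edge (x, w)"
      unfolding labelled_edge_def prod.case val using lx lw fx fw by blast
    moreover have "b = True" using True by simp
    ultimately show ?thesis unfolding e w_def by (simp only: half.simps)
  next
    case False
    have "\<exists>t. farey_neighbors t (vertex_farey w) \<and> farey_neighbors t (vertex_farey y) \<and>
        t \<noteq> vertex_farey (mediant (w, y)) \<and> markov_label (horoball t) (k2 * n - k * n2)"
      using nb(3,4) ne2 lx unfolding m(3) by blast
    then have "labelled_edge (w, y)"
      unfolding labelled_edge_def prod.case val using ly lw fy fw by blast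
    moreover have "b = False" using False by simp
    ultimately show ?thesis unfolding e w_def by (simp only: half.simps)
  qed
qed

lemma labelled_walk: "labelled_edge (fold half bs unit_edge)"
proof (induction bs rule: rev_induct)
  case Nil
  then show ?case by (simp add: labelled_unit_edge)
next
  case (snoc b bs)
  then show ?case using labelled_half[OF good_walk[OF good_unit_edge]] by simp
qed

definition tree_edge :: "vertex \<Rightarrow> vertex \<Rightarrow> bool" where
  "tree_edge x y \<longleftrightarrow> (\<exists>bs. fold half bs unit_edge = (x, y))"

lemma tree_edge_good: "tree_edge x y \<Longrightarrow> good_edge (x, y)"
  unfolding tree_edge_def using good_walk[OF good_unit_edge] by metis

lemma tree_edge_half:
  assumes "tree_edge x y"
  shows "tree_edge x (mediant (x, y))" "tree_edge (mediant (x, y)) y"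
proof -
  obtain bs where bs: "fold half bs unit_edge = (x, y)" using assms by (auto simp: tree_edge_def)
  have "fold half (bs @ [True]) unit_edge = (x, mediant (x, y))"
    "fold half (bs @ [False]) unit_edge = (mediant (x, y), y)"
    using bs by (simp_all del: mediant.simps)
  then show "tree_edge x (mediant (x, y))" "tree_edge (mediant (x, y)) y"
    unfolding tree_edge_def by blast+
qed

lemma tree_edge_labels:
  assumes "tree_edge x y"
  shows "lambda_M (vertex_horoball x) = vertex_markov x" "lambda_M (vertex_horoball y) = vertex_markov y"
    and "lambda_FM (vertex_horoball x) = fm_label x" "lambda_FM (vertex_horoball y) = fm_label y"
proof -
  have "labelled_edge (x, y)" using assms labelled_walk by (auto simp: tree_edge_def) metis
  then show "lambda_M (vertex_horoball x) = vertex_markov x" "lambda_M (vertex_horoball y) = vertex_markov y"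
    "lambda_FM (vertex_horoball x) = fm_label x" "lambda_FM (vertex_horoball y) = fm_label y"
    unfolding labelled_edge_def prod.case using lambda_M_eq lambda_FM_eq by blast+
qed

lemma tree_edge_ordered_triple:
  assumes t: "tree_edge x y"
  defines "w \<equiv> mediant (x, y)"
  shows "ordered_markov_triple (vertex_markov x) (vertex_markov w) (vertex_markov y)
    (vertex_horoball x) (vertex_horoball w) (vertex_horoball y)"
proof -
  obtain p1 q1 k1 n1 p2 q2 k2 n2 where xy: "x = (p1, q1, k1, n1)" "y = (p2, q2, k2, n2)"
    by (metis prod.collapse)
  have gm: "markov_edge k1 n1 k2 n2" using tree_edge_good[OF t] by (simp add: xy)
  note prec = good_edge_precedents[OF tree_edge_good[OF t], folded w_def]
  have mt: "markov_triple (vertex_markov x) (vertex_markov w) (vertex_markov y)"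
   
      using markov_edge_mediant(4)[OF gm] gm by (auto simp: markov_triple_def markov_edge_def w_def xy)
  obtain r s v where rsv: "vertex_farey x = Frac r" "vertex_farey w = Frac s" "vertex_farey y = Frac v"
    by (metis prod.collapse vertex_farey.simps)
  have "r < s" "s < v" using prec(1) unfolding immediate_precedents_def rsv by simp_all
  then have less: "lambda_F (vertex_horoball x) < lambda_F (vertex_horoball w)"
      "lambda_F (vertex_horoball w) < lambda_F (vertex_horoball y)"
    unfolding rsv lambda_F_horoball by simp_all
  show ?thesis
    unfolding ordered_markov_triple_def horoball_precedents_def
   
      using mt less prec tree_edge_labels[OF t] tree_edge_labels[OF tree_edge_half(1)[OF t], folded w_def]
    by blast
qed

text \<open>The precedents of a fraction in the unit interval have determinant 1, hence form an edge of
  the tree, and the tree carries the labels of the horoballs.\<close>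
lemma ordered_triple_from_tree:
  assumes "ordered_markov_triple n1 n n2 H1 H H2"
  obtains x y where "tree_edge x y" "H1 = vertex_horoball x" "H2 = vertex_horoball y"
    "H = vertex_horoball (mediant (x, y))" "n1 = vertex_markov x" "n2 = vertex_markov y"
    "n = vertex_markov (mediant (x, y))"
proof -
  obtain u v w where uvw: "H1 = horoball u" "H2 = horoball v" "H = horoball w" "immediate_precedents u v w"
    using assms by (auto simp: ordered_markov_triple_def horoball_precedents_def)
  note d = immediate_precedents_det[OF uvw(4)]
  have unit: "horoball u \<in> unit_horoballs" "horoball v \<in> unit_horoballs"
    using assms uvw by (simp_all add: ordered_markov_triple_def)
  have "0 < den u" "0 < den v"
    using unit den_nonneg[of u] den_eq_0_iff[of u] den_nonneg[of v] den_eq_0_iff[of v]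
    unfolding horoball_unit_iff by auto
  then obtain bs k1 m1 k2 m2 where
    bs: "fold half bs unit_edge = ((num u, den u, k1, m1), (num v, den v, k2, m2))"
    using farey_edge_reached[OF d(3)] unit unfolding horoball_unit_iff by metis
  define x y where "x = (num u, den u, k1, m1)" "y = (num v, den v, k2, m2)"
  have t: "tree_edge x y" unfolding tree_edge_def using bs x_y_def by blast
  note nd = good_edge_num_den[OF tree_edge_good[OF t, unfolded x_y_def]]
  have u: "vertex_farey x = u" and v: "vertex_farey y = v"
    unfolding x_y_def vertex_farey.simps by (rule farey_eqI; simp only: nd)+
  note d' = immediate_precedents_det[OF good_edge_precedents(1)[OF tree_edge_good[OF t]]]
  have w: "vertex_farey (mediant (x, y)) = w"
    by (rule farey_eqI) (simp_all only: d' d u v)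
  show ?thesis
    using that[OF t] tree_edge_ordered_triple[OF t] assms uvw(1-3) u v w
    unfolding ordered_markov_triple_def by metis
qed

section \<open>The two fans of horoballs around a central one\<close>

fun left_fan :: "vertex \<Rightarrow> vertex \<Rightarrow> nat \<Rightarrow> vertex" where
  "left_fan x w 0 = x"
| "left_fan x w (Suc i) = mediant (left_fan x w i, w)"

fun right_fan :: "vertex \<Rightarrow> vertex \<Rightarrow> nat \<Rightarrow> vertex" where
  "right_fan w y 0 = y"
| "right_fan w y (Suc i) = mediant (w, right_fan w y i)"

lemma tree_edge_left_fan: "tree_edge x w \<Longrightarrow> tree_edge (left_fan x w i) w"
  by (induction i) (simp_all add: tree_edge_half del: mediant.simps)

lemma tree_edge_right_fan: "tree_edge w y \<Longrightarrow> tree_edge w (right_fan w y i)"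
  by (induction i) (simp_all add: tree_edge_half del: mediant.simps)

text \<open>In the edge from \<open>left_fan x w i\<close> to \<open>w\<close> the vertex left behind is \<open>left_fan x w (i - 1)\<close>, if
  \<open>i > 0\<close>, so the mediant rule becomes the three-term recursion with coefficient \<open>3 * n\<close>.\<close>
lemma left_fan_labels:
  assumes t: "tree_edge x w"
  defines "n \<equiv> vertex_markov w" and "k \<equiv> vertex_fm_num w"
  defines "d \<equiv> k * vertex_markov x - vertex_fm_num x * n"
  shows "vertex_markov (left_fan x w i) = chain n d (vertex_markov x) (Suc i) \<and>
    k * vertex_markov (left_fan x w i) - vertex_fm_num (left_fan x w i) * n = chain n d (vertex_markov x) i"
proof (induction i)
  case 0
  then show ?case by (simp add: d_def)
next
  case (Suc i)
  obtain p q \<kappa> c where z: "left_fan x w i = (p, q, \<kappa>, c)" by (metis prod.collapse)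
  obtain pw qw where w: "w = (pw, qw, k, n)"
    unfolding k_def n_def by (metis prod.collapse vertex_fm_num.simps vertex_markov.simps)
  have g: "markov_edge \<kappa> c k n"
    using tree_edge_good[OF tree_edge_left_fan[OF t, of i], unfolded z, unfolded w] by simp
  have c: "c = chain n d (vertex_markov x) (Suc i)" and d: "k * c - \<kappa> * n = chain n d (vertex_markov x) i"
    using Suc unfolding z vertex_markov.simps vertex_fm_num.simps by blast+
  have "3 * c * n - (k * c - \<kappa> * n) = chain n d (vertex_markov x) (Suc (Suc i))"
    unfolding d by (simp add: c)
  then show ?case
    using markov_edge_mediant(3)[OF g] c unfolding left_fan.simps z unfolding w by simp
qed

lemma right_fan_labels:
  assumes t: "tree_edge w y"
  defines "n \<equiv> vertex_markov w" and "k \<equiv> vertex_fm_num w"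
  defines "d \<equiv> vertex_fm_num y * n - k * vertex_markov y"
  shows "vertex_markov (right_fan w y i) = chain n d (vertex_markov y) (Suc i) \<and>
    vertex_fm_num (right_fan w y i) * n - k * vertex_markov (right_fan w y i) = chain n d (vertex_markov y) i"
proof (induction i)
  case 0
  then show ?case by (simp add: d_def)
next
  case (Suc i)
  obtain p q \<kappa> c where z: "right_fan w y i = (p, q, \<kappa>, c)" by (metis prod.collapse)
  obtain pw qw where w: "w = (pw, qw, k, n)"
    unfolding k_def n_def by (metis prod.collapse vertex_fm_num.simps vertex_markov.simps)
  have g: "markov_edge k n \<kappa> c"
    using tree_edge_good[OF tree_edge_right_fan[OF t, of i], unfolded z, unfolded w] by simp
  have c: "c = chain n d (vertex_markov y) (Suc i)" and d: "\<kappa> * n - k * c = chain n d (vertex_markov y) i"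
    using Suc unfolding z vertex_markov.simps vertex_fm_num.simps by blast+
  have "3 * n * c - (\<kappa> * n - k * c) = chain n d (vertex_markov y) (Suc (Suc i))"
    unfolding d by (simp add: c)
  then show ?case
    using markov_edge_mediant(2)[OF g] c unfolding right_fan.simps z unfolding w by simp
qed

section \<open>Ratios of consecutive chain entries\<close>

lemma markov_chain:
  fixes n x0 x1 :: int
  assumes "n > 0" "x0 > 0" "x1 > 0" "x0\<^sup>2 + x1\<^sup>2 + n\<^sup>2 = 3 * n * x0 * x1"
  shows "chain n x0 x1 i > 0 \<and> (chain n x0 x1 i)\<^sup>2 + (chain n x0 x1 (Suc i))\<^sup>2 + n\<^sup>2
      = 3 * n * chain n x0 x1 i * chain n x0 x1 (Suc i) \<and> chain n x0 x1 (Suc i) > 0"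
proof (induction i)
  case 0
  then show ?case using assms by simp
next
  case (Suc i)
  define b c where "b = chain n x0 x1 i" "c = chain n x0 x1 (Suc i)"
  have d: "chain n x0 x1 (Suc (Suc i)) = 3 * n * c - b" by (simp add: b_c_def)
  have IH: "b > 0" "b\<^sup>2 + c\<^sup>2 + n\<^sup>2 = 3 * n * b * c" "c > 0"
    using Suc by (simp_all add: b_c_def)
  have prod: "b * (3 * n * c - b) = c\<^sup>2 + n\<^sup>2"
    using IH(2) by (simp add: algebra_simps power2_eq_square)
  have "c\<^sup>2 + n\<^sup>2 > 0" using IH(3) by (simp add: add_pos_nonneg)
  then have pos: "3 * n * c - b > 0" using prod IH(1) by (metis zero_less_mult_pos)
  have "c\<^sup>2 + (3 * n * c - b)\<^sup>2 + n\<^sup>2 = b * (3 * n * c - b) + (3 * n * c - b)\<^sup>2"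
    using prod by simp
  also have "\<dots> = 3 * n * c * (3 * n * c - b)" by (simp add: algebra_simps power2_eq_square)
  finally show ?case using pos IH(3) unfolding d b_c_def(2)[symmetric] by simp
qed

text \<open>The cross difference \<open>x\<^sub>i\<^sub>+\<^sub>2 * x\<^sub>i - x\<^sub>i\<^sub>+\<^sub>1\<^sup>2\<close> equals \<open>n\<^sup>2\<close> by the Markov equation.\<close>
lemma chain_ratio_less:
  fixes n x0 x1 :: int
  assumes "n > 0" "x0 > 0" "x1 > 0" "x0\<^sup>2 + x1\<^sup>2 + n\<^sup>2 = 3 * n * x0 * x1"
  defines "x \<equiv> chain n x0 x1"
  shows "real_of_int (x (Suc i)) / x i < real_of_int (x (Suc (Suc i))) / x (Suc i)"
proof -
  note m = markov_chain[OF assms(1-4), of i, folded x_def]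
  define b c where "b = x i" "c = x (Suc i)"
  have d: "x (Suc (Suc i)) = 3 * n * c - b" by (simp add: x_def b_c_def)
  have "x (Suc (Suc i)) * x i - x (Suc i) * x (Suc i) = 3 * n * b * c - b\<^sup>2 - c\<^sup>2"
    unfolding d b_c_def[symmetric] by (simp add: algebra_simps power2_eq_square)
  also have "\<dots> = n\<^sup>2" using m by (simp add: b_c_def)
  finally have "x (Suc i) * x (Suc i) < x (Suc (Suc i)) * x i"
    using assms(1) by (smt (verit) zero_less_power)
  then have "real_of_int (x (Suc i) * x (Suc i)) < real_of_int (x (Suc (Suc i)) * x i)"
    by (simp only: of_int_less_iff)
  then show ?thesis using m by (simp add: divide_less_eq less_divide_eq field_simps)
qed

text \<open>The ratios satisfy \<open>r\<^sub>i\<^sub>+\<^sub>1 * r\<^sub>i = 3 * n * r\<^sub>i - 1\<close>. They increase and stay below \<open>3 * n\<close>, hence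
  converge to the larger root of \<open>t\<^sup>2 - 3 * n * t + 1\<close>.\<close>
lemma chain_ratio_limit:
  fixes n x0 x1 :: int
  assumes "n > 0" "x0 > 0" "x1 > 0" "x0\<^sup>2 + x1\<^sup>2 + n\<^sup>2 = 3 * n * x0 * x1"
    and large: "x1 < 3 * n * x1 - x0"
  defines "x \<equiv> chain n x0 x1"
  shows "(\<lambda>i. real_of_int (x (Suc i)) / x i) \<longlonglongrightarrow> (3 * n + sqrt (9 * (real_of_int n)\<^sup>2 - 4)) / 2"
proof -
  define r where "r i = real_of_int (x (Suc i)) / x i" for i
  note m = markov_chain[OF assms(1-4), folded x_def]
  have rec: "r (Suc i) * r i = 3 * n * r i - 1" for i
    using m[of i] m[of "Suc i"] by (simp add: r_def x_def field_simps)
  have inc: "incseq r"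
    unfolding r_def
      using chain_ratio_less[OF assms(1-4), folded x_def] by (intro incseq_SucI less_imp_le)
  have bound: "r i \<le> 3 * n" for i
  proof -
    have "r i > 0" using m[of i] by (simp add: r_def)
    moreover have "r (Suc i) * r i \<le> (3 * n) * r i" using rec by simp
    ultimately have "r (Suc i) \<le> 3 * n" by (simp add: mult_le_cancel_right_pos)
    then show ?thesis using incseq_SucD[OF inc, of i] by linarith
  qed
  obtain l where l: "r \<longlonglongrightarrow> l" "\<And>i. r i \<le> l"
    using incseq_convergent[OF inc, of "3 * n"] bound by blast
  have "(\<lambda>i. r (Suc i) * r i) \<longlonglongrightarrow> l * l"
    by (intro tendsto_mult LIMSEQ_Suc l(1))
  moreover have "(\<lambda>i. r (Suc i) * r i) \<longlonglongrightarrow> 3 * n * l - 1"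
    unfolding rec by (intro tendsto_intros l(1))
  ultimately have eq: "l * l = 3 * n * l - 1" by (rule LIMSEQ_unique)
  have "real_of_int x1 < real_of_int (3 * n * x1 - x0)" using large by (simp only: of_int_less_iff)
  moreover have "r 1 = real_of_int (3 * n * x1 - x0) / x1" by (simp add: r_def x_def)
  ultimately have "1 < r 1" using assms(3) by (simp del: of_int_diff)
  then have "l > 1" using l(2)[of 1] by linarith
  have "l * (3 * n - l) = 1" using eq by (simp add: algebra_simps)
  then have "3 * n - l = 1 / l" using \<open>l > 1\<close> by (simp add: field_simps)
  moreover have "1 / l < 1" using \<open>l > 1\<close> by simp
  ultimately have "2 * l - 3 * n \<ge> 0" using \<open>l > 1\<close> by linarith
  moreover have "(2 * l - 3 * n)\<^sup>2 = 9 * (real_of_int n)\<^sup>2 - 4"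
    using eq by (simp add: power2_eq_square algebra_simps)
  ultimately have "2 * l - 3 * n = sqrt (9 * (real_of_int n)\<^sup>2 - 4)"
    by (metis real_sqrt_unique)
  then have "l = (3 * n + sqrt (9 * (real_of_int n)\<^sup>2 - 4)) / 2" by simp
  then show ?thesis using l(1) unfolding r_def[abs_def] by (simp only:)
qed

section \<open>The quadratic equation\<close>

lemma integral_solutions_iff:
  assumes "n > 0"
  shows "(x, y) \<in> integral_solutions n k \<longleftrightarrow>
    (n * x - k * y)\<^sup>2 + y\<^sup>2 + n\<^sup>2 = 3 * (n * x - k * y) * y * n"
proof -
  define N K X Y where r: "N = real_of_int n" "K = real_of_int k" "X = real_of_int x" "Y = real_of_int y"
  have N: "N > 0" using assms by (simp add: r)
  define Q where "Q = N * X\<^sup>2 - (3 * N + 2 * K) * X * Y + (3 * K + (1 + K\<^sup>2) / N) * Y\<^sup>2"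
  define T where "T = (1 + K\<^sup>2) / N"
  have T: "N * T = 1 + K\<^sup>2" using N by (simp add: T_def)
  have "N * Q = N * (N * X\<^sup>2 - (3 * N + 2 * K) * X * Y + 3 * K * Y\<^sup>2) + (N * T) * Y\<^sup>2"
    unfolding Q_def T_def[symmetric] by (simp add: algebra_simps)
  then have NQ: "N * Q + N\<^sup>2 = (N * X - K * Y)\<^sup>2 + Y\<^sup>2 + N\<^sup>2 - 3 * (N * X - K * Y) * Y * N"
    unfolding T by (simp add: algebra_simps power2_eq_square)
  have "(x, y) \<in> integral_solutions n k \<longleftrightarrow> Q = - N"
    by (simp add: integral_solutions_def Q_def r)
  also have "\<dots> \<longleftrightarrow> N * (Q + N) = 0" using N by auto
  also have "\<dots> \<longleftrightarrow> N * Q + N\<^sup>2 = 0"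
    by (simp add: distrib_left power2_eq_square)
  also have "\<dots> \<longleftrightarrow> (N * X - K * Y)\<^sup>2 + Y\<^sup>2 + N\<^sup>2 = 3 * (N * X - K * Y) * Y * N"
    unfolding NQ by (rule right_minus_eq)
  also have "\<dots> \<longleftrightarrow> real_of_int ((n * x - k * y)\<^sup>2 + y\<^sup>2 + n\<^sup>2) = real_of_int (3 * (n * x - k * y) * y * n)"
    by (simp add: r)
  also have "\<dots> \<longleftrightarrow> (n * x - k * y)\<^sup>2 + y\<^sup>2 + n\<^sup>2 = 3 * (n * x - k * y) * y * n"
    by (simp only: of_int_eq_iff)
  finally show ?thesis .
qed

lemma solution_ratio:
  assumes "n > 0" "y \<noteq> 0"
  shows "real_of_int x / y = real_of_int k / n + (real_of_int (n * x - k * y) / y) / n"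
  using assms by (simp add: field_simps)

text \<open>With \<open>z = n * x - k * y\<close>, the Markov equation forces \<open>z * y > 0\<close> and \<open>z\<^sup>2 < 3 * n * z * y\<close>, so the
  bounds on \<open>x / y\<close> hold for every solution.\<close>
lemma solution_in_range:
  assumes "n > 0" "(x, y) \<in> integral_solutions n k" "y \<noteq> 0"
  shows "(n * x - k * y) * y > 0"
    and "real_of_int k / n \<le> real_of_int x / y" "real_of_int x / y \<le> 3 + real_of_int k / n"
proof -
  define z where "z = n * x - k * y"
  have M: "z\<^sup>2 + y\<^sup>2 + n\<^sup>2 = 3 * z * y * n"
    using assms integral_solutions_iff by (simp add: z_def)
  have "z\<^sup>2 + y\<^sup>2 + n\<^sup>2 > 0" using assms(1) by (simp add: add_nonneg_pos)
  then have "0 < (z * y) * (3 * n)" using M by (simp add: algebra_simps)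
  then have zy: "z * y > 0" using assms(1) by (simp add: zero_less_mult_iff)
  then show "(n * x - k * y) * y > 0" by (simp add: z_def)
  have div: "real_of_int z / y = real_of_int (z * y) / (real_of_int y)\<^sup>2"
    using assms(3) by (simp add: power2_eq_square)
  then have "real_of_int z / y \<ge> 0" using zy by (simp del: of_int_mult)
  then have "(real_of_int z / y) / n \<ge> 0"
    using assms(1) by (auto intro: divide_nonneg_pos simp del: divide_divide_eq_left zero_le_divide_iff)
  then show "real_of_int k / n \<le> real_of_int x / y"
    unfolding solution_ratio[OF assms(1,3), of x k] z_def[symmetric] by linarith
  have "3 * z * y * n = 3 * (z * y) * n" by (simp add: mult.assoc)
  then have "z\<^sup>2 \<le> 3 * (z * y) * n"
    using M zero_le_power2[of y] zero_le_power2[of n] by linarith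
  then have "(z * y)\<^sup>2 \<le> (z * y) * (3 * n * y\<^sup>2)"
    using mult_right_mono[of "z\<^sup>2" "3 * (z * y) * n" "y\<^sup>2"]
      by (simp add: power_mult_distrib algebra_simps)
  then have "(z * y) * (z * y) \<le> (z * y) * (3 * n * y\<^sup>2)" by (simp only: power2_eq_square)
  then have "z * y \<le> 3 * n * y\<^sup>2" using zy by (rule mult_left_le_imp_le)
  then have "real_of_int (z * y) \<le> real_of_int (3 * n * y\<^sup>2)"
    by (simp only: of_int_le_iff)
  then have "real_of_int (z * y) \<le> real_of_int (3 * n) * (real_of_int y)\<^sup>2"
    by (simp only: of_int_mult of_int_power of_int_numeral)
  moreover have "(real_of_int y)\<^sup>2 > 0" using assms(3) by simp
  ultimately have "real_of_int z / y \<le> 3 * n" unfolding div by (subst pos_divide_le_eq)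
  then have "(real_of_int z / y) / n \<le> 3" using assms(1) by (subst pos_divide_le_eq) simp_all
  then show "real_of_int x / y \<le> 3 + real_of_int k / n"
    unfolding solution_ratio[OF assms(1,3), of x k] z_def[symmetric] by linarith
qed

section \<open>Solutions and ordered triples\<close>

theorem proposition7p4:
  fixes n1 n n2 k1 k k2 :: int
    and H1 H H2 :: "complex set"
    and L :: real
  assumes "ordered_markov_triple n1 n n2 H1 H H2"
    and "lambda_FM H1 = of_int k1 / of_int n1"
    and "lambda_FM H = of_int k / of_int n"
    and "lambda_FM H2 = of_int k2 / of_int n2"
    and "L = 3 - sqrt (9 - 4 / (real_of_int n)\<^sup>2)"
  shows "\<exists>(a :: nat \<Rightarrow> int) (c :: nat \<Rightarrow> int) (a' :: nat \<Rightarrow> int) (c' :: nat \<Rightarrow> int)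
          (G :: nat \<Rightarrow> complex set) (G' :: nat \<Rightarrow> complex set).
      {(x, y) \<in> integral_solutions n k. y \<noteq> 0 \<and>
          real_of_int k / real_of_int n \<le> real_of_int x / real_of_int y \<and>
          real_of_int x / real_of_int y \<le> 3 + real_of_int k / real_of_int n}
        = {(s * a i, s * c i) | s i. s \<in> {1, -1} \<and> 1 \<le> i}
          \<union> {(s * a' i, s * c' i) | s i. s \<in> {1, -1} \<and> 1 \<le> i}
    \<and> real_of_int (a 1) / real_of_int (c 1) = 3 + real_of_int k1 / real_of_int n1
    \<and> (\<forall>i\<ge>1. real_of_int (a i) / real_of_int (c i)
              < real_of_int (a (i + 1)) / real_of_int (c (i + 1)))
    \<and> (\<lambda>i. real_of_int (a i) / real_of_int (c i))
        \<longlonglongrightarrow> 3 + real_of_int k / real_of_int n - 1 / 2 * L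
    \<and> (\<forall>i\<ge>1. ordered_markov_triple (c i) (c (i + 1)) n (G i) (G (i + 1)) H)
    \<and> (\<forall>i\<ge>1. of_int (a i) / of_int (c i) = 3 + lambda_FM (G i))
    \<and> real_of_int (a' 1) / real_of_int (c' 1) = real_of_int k2 / real_of_int n2
    \<and> (\<forall>i\<ge>1. real_of_int (a' i) / real_of_int (c' i)
              > real_of_int (a' (i + 1)) / real_of_int (c' (i + 1)))
    \<and> (\<lambda>i. real_of_int (a' i) / real_of_int (c' i))
        \<longlonglongrightarrow> real_of_int k / real_of_int n + 1 / 2 * L
    \<and> (\<forall>i\<ge>1. ordered_markov_triple n (c' (i + 1)) (c' i) H (G' (i + 1)) (G' i))
    \<and> (\<forall>i\<ge>1. of_int (a' i) / of_int (c' i) = lambda_FM (G' i))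
    \<and> c 1 = n1
    \<and> real_of_int (a 1) = 3 * real_of_int n1
          + (real_of_int k * real_of_int n1 - real_of_int n2) / real_of_int n
    \<and> (a 1, c 1) \<in> integral_solutions n k
    \<and> real_of_int (a 1) / real_of_int (c 1) \<ge> 3 / 2 + real_of_int k / real_of_int n
    \<and> (\<forall>(x, y) \<in> integral_solutions n k.
          y \<noteq> 0 \<and> real_of_int x / real_of_int y \<ge> 3 / 2 + real_of_int k / real_of_int n
          \<and> (x, y) \<noteq> (a 1, c 1) \<and> (x, y) \<noteq> (- a 1, - c 1)
          \<longrightarrow> real_of_int (a 1) / real_of_int (c 1) < real_of_int x / real_of_int y)"
proof -
  obtain u v where t: "tree_edge u v" and H1: "H1 = vertex_horoball u" and H2: "H2 = vertex_horoball v"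
    and H: "H = vertex_horoball (mediant (u, v))"
    and n1: "n1 = vertex_markov u" and n2: "n2 = vertex_markov v" and n: "n = vertex_markov (mediant (u, v))"
    using ordered_triple_from_tree[OF assms(1)] by metis
  define w where "w = mediant (u, v)"
  obtain p1 q1 \<kappa>1 p2 q2 \<kappa>2 where uv: "u = (p1, q1, \<kappa>1, n1)" "v = (p2, q2, \<kappa>2, n2)"
    using n1 n2 by (metis prod.collapse vertex_markov.simps)
  obtain p q \<kappa> where w: "w = (p, q, \<kappa>, n)"
    using n unfolding w_def[symmetric] by (metis prod.collapse vertex_markov.simps)
  have g: "markov_edge \<kappa>1 n1 \<kappa>2 n2" using tree_edge_good[OF t] by (simp add: uv)
  have \<kappa>: "\<kappa> = (\<kappa>1 * n1 + \<kappa>2 * n2) div (\<kappa>2 * n1 - \<kappa>1 * n2)"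
    and n_eq: "n = 3 * n1 * n2 - (\<kappa>2 * n1 - \<kappa>1 * n2)"
    using w unfolding w_def uv by auto
  note m = markov_edge_mediant[OF g, folded \<kappa> n_eq]
  have pos: "n1 > 0" "n2 > 0" "n > 0" and less: "n1 < n" "n2 < n"
    using g m(5,6) unfolding markov_edge_def n_eq[symmetric] by auto
  note tl = tree_edge_half(1)[OF t, folded w_def] and tr = tree_edge_half(2)[OF t, folded w_def]
  have k: "k1 = \<kappa>1" "k = \<kappa>" "k2 = \<kappa>2"
    using assms(2-4) tree_edge_labels(3,4)[OF t] tree_edge_labels(4)[OF tl] pos
    unfolding H1 H2 H w_def[symmetric] by (simp_all add: uv w)
  have r1: "k * n1 - k1 * n = n2" and r2: "k2 * n - k * n2 = n1" using m(2,3) by (simp_all add: k)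
  have M: "n2\<^sup>2 + n1\<^sup>2 + n\<^sup>2 = 3 * n * n2 * n1" "n1\<^sup>2 + n2\<^sup>2 + n\<^sup>2 = 3 * n * n1 * n2"
    using m(4) by (simp_all add: algebra_simps)

  \<comment> \<open>The index 0 continues each sequence one step beyond its start, where it meets the other one:
      \<open>c 0 = n2 = c' 1\<close> and \<open>c' 0 = n1 = c 1\<close>. The horoballs start at index 1.\<close>
  define c where "c = chain n n2 n1"
  define c' where "c' = chain n n1 n2"
  define X where "X i = left_fan u w (i - 1)" for i
  define Y where "Y i = right_fan w v (i - 1)" for i
  define a where "a i = 3 * c i + vertex_fm_num (X i)" for i
  define a' where "a' i = vertex_fm_num (Y i)" for i
  define G where "G i = vertex_horoball (X i)" for i
  define G' where "G' i = vertex_horoball (Y i)" for i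
  have Hw: "H = vertex_horoball w" using H by (simp add: w_def)

  have val: "vertex_markov w = n" "vertex_fm_num w = k" "vertex_markov u = n1" "vertex_fm_num u = k1"
    "vertex_markov v = n2" "vertex_fm_num v = k2"
    by (simp_all add: w uv k)
  have X: "vertex_markov (X i) = c i" "k * c i - vertex_fm_num (X i) * n = c (i - 1)" if "i \<ge> 1" for i
  proof -
    obtain j where j: "i = Suc j" using \<open>i \<ge> 1\<close> by (cases i) auto
    note l = left_fan_labels[OF tl, of j, unfolded val r1, folded c_def]
    show "vertex_markov (X i) = c i" "k * c i - vertex_fm_num (X i) * n = c (i - 1)"
      unfolding j X_def diff_Suc_1 using l by metis+
  qed
  have Y: "vertex_markov (Y i) = c' i" "vertex_fm_num (Y i) * n - k * c' i = c' (i - 1)" if "i \<ge> 1" for i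
  proof -
    obtain j where j: "i = Suc j" using \<open>i \<ge> 1\<close> by (cases i) auto
    note l = right_fan_labels[OF tr, of j, unfolded val r2, folded c'_def]
    show "vertex_markov (Y i) = c' i" "vertex_fm_num (Y i) * n - k * c' i = c' (i - 1)"
      unfolding j Y_def diff_Suc_1 using l by metis+
  qed
  have c_pos: "c i > 0" and c'_pos: "c' i > 0" for i
   
      using markov_chain[OF pos(3,2,1) M(1)] markov_chain[OF pos(3,1,2) M(2)] by (auto simp: c_def c'_def)
  have c_rec: "c (i + 1) = 3 * n * c i - c (i - 1)" if "i \<ge> 1" for i
    using that by (cases i) (simp_all add: c_def)
  have a_eq: "n * a i - k * c i = c (i + 1)" if "i \<ge> 1" for i
    using X(2)[OF that] c_rec[OF that] by (simp add: a_def algebra_simps)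
  have a'_eq: "n * a' i - k * c' i = c' (i - 1)" if "i \<ge> 1" for i
    using Y(2)[OF that] by (simp add: a'_def algebra_simps)
  have mc: "(c i)\<^sup>2 + (c (Suc i))\<^sup>2 + n\<^sup>2 = 3 * n * c i * c (Suc i)"
    "(c' i)\<^sup>2 + (c' (Suc i))\<^sup>2 + n\<^sup>2 = 3 * n * c' i * c' (Suc i)" for i
   
      using markov_chain[OF pos(3,2,1) M(1)] markov_chain[OF pos(3,1,2) M(2)] by (simp_all add: c_def c'_def)
  have sol: "(a i, c i) \<in> integral_solutions n k" if "i \<ge> 1" for i
    unfolding integral_solutions_iff[OF pos(3)] a_eq[OF that]
      using mc(1)[of i] by (simp add: algebra_simps)
  have sol': "(a' i, c' i) \<in> integral_solutions n k" if "i \<ge> 1" for i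
    unfolding integral_solutions_iff[OF pos(3)] a'_eq[OF that] using mc(2)[of "i - 1"] that
    by (simp add: algebra_simps)
  have sol_neg: "(- x, - y) \<in> integral_solutions n k \<longleftrightarrow> (x, y) \<in> integral_solutions n k" for x y
    by (simp add: integral_solutions_def)

  have ratio: "real_of_int (a i) / c i = real_of_int k / n + (real_of_int (c (i + 1)) / c i) / n" if "i \<ge> 1" for i
    unfolding a_eq[OF that, symmetric] using c_pos[of i] by (intro solution_ratio pos) simp
  have ratio': "real_of_int (a' i) / c' i = real_of_int k / n + (real_of_int (c' (i - 1)) / c' i) / n" if "i \<ge> 1" for i
    unfolding a'_eq[OF that, symmetric] using c'_pos[of i] by (intro solution_ratio pos) simp

  \<comment> \<open>Each solution gives a Markov triple on one of the chains, and the chain entries recover it.\<close>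
  have pos_sol: "\<exists>i\<ge>1. (x, y) = (a i, c i) \<or> (x, y) = (a' i, c' i)"
    if xy: "(x, y) \<in> integral_solutions n k" "y > 0" for x y
  proof -
    define z where "z = n * x - k * y"
    have "z * y > 0" using solution_in_range(1)[OF pos(3) xy(1)] xy(2) by (simp add: z_def)
    then have "z > 0" using xy(2) by (simp add: zero_less_mult_iff)
    moreover have "z\<^sup>2 + y\<^sup>2 + n\<^sup>2 = 3 * z * y * n"
      using xy(1) integral_solutions_iff[OF pos(3)] by (simp add: z_def)
    moreover have "n dvd z + \<kappa> * y" by (simp add: z_def k)
    moreover obtain bs where "fold half bs unit_edge = ((p1, q1, \<kappa>1, n1), (p2, q2, \<kappa>2, n2))"
      using t uv by (auto simp: tree_edge_def)
    ultimately have "on_chains n n1 n2 z y"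
      using markov_triples_on_chains[OF _ \<kappa> n_eq] xy(2) by blast
    then obtain i where "z = c' i \<and> y = c' (Suc i) \<or> z = c (Suc i) \<and> y = c i"
      by (auto simp: on_chains_def c_def c'_def)
    moreover have ?thesis if zy: "z = c' i" "y = c' (Suc i)" for i
    proof -
      have "n * a' (Suc i) - k * y = z" using a'_eq[of "Suc i"] zy by simp
      then have "n * x = n * a' (Suc i)" unfolding z_def by linarith
      then have "x = a' (Suc i)" using pos by simp
      then show ?thesis using zy by (intro exI[of _ "Suc i"]) simp
    qed
    moreover have ?thesis if zy: "z = c (Suc i)" "y = c i" for i
    proof (cases i)
      \<comment> \<open>The first pair of the left chain is \<open>(n1, n2)\<close>, which belongs to the first solution of the
          right sequence.\<close>
      case 0
      then have "z = c' 0" "y = c' (Suc 0)" using zy by (simp_all add: c_def c'_def)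
      then show ?thesis using \<open>\<And>i. z = c' i \<Longrightarrow> y = c' (Suc i) \<Longrightarrow> ?thesis\<close> by blast
    next
      case (Suc j)
      have "n * a i - k * y = z" using a_eq[of i] zy Suc by simp
      then have "n * x = n * a i" unfolding z_def by linarith
      then have "x = a i" using pos by simp
      then show ?thesis using zy Suc by (intro exI[of _ i]) simp
    qed
    ultimately show ?thesis by blast
  qed

  have all_sol: "\<exists>s i. s \<in> {1, -1} \<and> 1 \<le> i \<and> ((x, y) = (s * a i, s * c i) \<or> (x, y) = (s * a' i, s * c' i))"
    if xy: "(x, y) \<in> integral_solutions n k" "y \<noteq> 0" for x y
  proof (cases "y > 0")
    case True
    from pos_sol[OF xy(1) this] show ?thesis by (metis insertCI mult_1)
  next
    case False
    then have "- y > 0" using xy(2) by simp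
    from pos_sol[OF sol_neg[THEN iffD2, OF xy(1)] this]
    obtain i where i: "i \<ge> 1" "(- x, - y) = (a i, c i) \<or> (- x, - y) = (a' i, c' i)" by blast
    then have "(x, y) = (-1 * a i, -1 * c i) \<or> (x, y) = (-1 * a' i, -1 * c' i)" by auto
    with i(1) show ?thesis by blast
  qed

  have set_eq: "{(x, y) \<in> integral_solutions n k. y \<noteq> 0 \<and>
          real_of_int k / real_of_int n \<le> real_of_int x / real_of_int y \<and>
          real_of_int x / real_of_int y \<le> 3 + real_of_int k / real_of_int n}
        = {(s * a i, s * c i) | s i. s \<in> {1, -1} \<and> 1 \<le> i}
          \<union> {(s * a' i, s * c' i) | s i. s \<in> {1, -1} \<and> 1 \<le> i}" (is "?L = ?R")
  proof (intro equalityI subrelI)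
    fix x y assume "(x, y) \<in> ?L"
    then show "(x, y) \<in> ?R" using all_sol[of x y] by blast
  next
    fix x y assume "(x, y) \<in> ?R"
    then obtain s i where "s = 1 \<or> s = -1" "1 \<le> i"
      "(x, y) = (s * a i, s * c i) \<or> (x, y) = (s * a' i, s * c' i)" by blast
    then have "(x, y) \<in> integral_solutions n k \<and> y \<noteq> 0"
      using sol[of i] sol'[of i] c_pos[of i] c'_pos[of i] sol_neg by auto
    then show "(x, y) \<in> ?L" using solution_in_range(2,3)[OF pos(3), of x y k] by simp
  qed

  have inc: "real_of_int (a i) / c i < real_of_int (a (i + 1)) / c (i + 1)" if "i \<ge> 1" for i
    using chain_ratio_less[OF pos(3,2,1) M(1), of i, folded c_def] ratio[of i] ratio[of "i + 1"] that pos(3)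
    by (simp add: divide_strict_right_mono del: divide_divide_eq_left)
  have dec: "real_of_int (a' i) / c' i > real_of_int (a' (i + 1)) / c' (i + 1)" if "i \<ge> 1" for i
  proof -
    obtain j where j: "i = Suc j" using \<open>i \<ge> 1\<close> by (cases i) auto
    have "real_of_int (c' (Suc j)) / c' j < real_of_int (c' (Suc (Suc j))) / c' (Suc j)"
      using chain_ratio_less[OF pos(3,1,2) M(2), of j] by (simp add: c'_def)
    then have "real_of_int (c' (Suc j)) / c' (Suc (Suc j)) < real_of_int (c' j) / c' (Suc j)"
      using c'_pos[of j] c'_pos[of "Suc j"] c'_pos[of "Suc (Suc j)"] by (simp add: field_simps)
    then show ?thesis
      using ratio'[of i] ratio'[of "i + 1"] j pos(3)
      by (simp add: divide_strict_right_mono del: divide_divide_eq_left)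
  qed

  define D where "D = sqrt (9 * (real_of_int n)\<^sup>2 - 4)"
  have n5: "n \<ge> 3" using m(5,6) by linarith
  have D: "sqrt (9 - 4 / (real_of_int n)\<^sup>2) = D / n"
  proof -
    have "9 - 4 / (real_of_int n)\<^sup>2 = (9 * (real_of_int n)\<^sup>2 - 4) / (real_of_int n)\<^sup>2"
      using pos by (simp add: field_simps)
    then show ?thesis using pos by (simp add: D_def real_sqrt_divide)
  qed
  have grow: "x < 3 * n * x - y" if "x > 0" "y < n" for x y
  proof -
    have "n \<le> n * x" "x \<le> n * x" using that pos by simp_all
    then show ?thesis using that pos by linarith
  qed
  have lim: "(\<lambda>i. real_of_int (c (Suc i)) / c i) \<longlonglongrightarrow> (3 * n + D) / 2"
    unfolding c_def D_def by (rule chain_ratio_limit[OF pos(3,2,1) M(1) grow[OF pos(1) less(2)]])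
  have lim': "(\<lambda>i. real_of_int (c' (Suc i)) / c' i) \<longlonglongrightarrow> (3 * n + D) / 2"
    unfolding c'_def D_def by (rule chain_ratio_limit[OF pos(3,1,2) M(2) grow[OF pos(2) less(1)]])
  have lim_a: "(\<lambda>i. real_of_int (a i) / real_of_int (c i))
        \<longlonglongrightarrow> 3 + real_of_int k / real_of_int n - 1 / 2 * L"
  proof (rule LIMSEQ_imp_Suc)
    have "(\<lambda>i. real_of_int k / n + (real_of_int (c (Suc (Suc i))) / c (Suc i)) / n)
        \<longlonglongrightarrow> real_of_int k / n + ((3 * n + D) / 2) / n"
      using pos by (intro tendsto_add tendsto_const tendsto_divide LIMSEQ_Suc[OF lim]) simp
    moreover have "real_of_int k / n + ((3 * n + D) / 2) / n = 3 + real_of_int k / n - 1 / 2 * L"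
      unfolding assms(5) D using pos by (simp add: field_simps)
    moreover have "real_of_int (a (Suc i)) / c (Suc i)
        = real_of_int k / n + (real_of_int (c (Suc (Suc i))) / c (Suc i)) / n" for i
      using ratio[of "Suc i"] by simp
    ultimately show "(\<lambda>i. real_of_int (a (Suc i)) / real_of_int (c (Suc i)))
        \<longlonglongrightarrow> 3 + real_of_int k / real_of_int n - 1 / 2 * L"
      by (simp only:)
  qed
  have D2: "D\<^sup>2 = 9 * (real_of_int n)\<^sup>2 - 4" "D \<ge> 0"
  proof -
    have "(real_of_int n)\<^sup>2 \<ge> 1" using n5 by simp
    then show "D\<^sup>2 = 9 * (real_of_int n)\<^sup>2 - 4" "D \<ge> 0" by (simp_all add: D_def)
  qed
  have lim_a': "(\<lambda>i. real_of_int (a' i) / real_of_int (c' i))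
        \<longlonglongrightarrow> real_of_int k / real_of_int n + 1 / 2 * L"
  proof (rule LIMSEQ_imp_Suc)
    have "3 * n + D > 0" using pos D2 by (simp add: add_pos_nonneg)
    \<comment> \<open>The two roots of the characteristic polynomial have product 1.\<close>
    have inv: "inverse ((3 * n + D) / 2) = (3 * n - D) / 2"
    proof -
      have "(3 * n + D) * (3 * n - D) = 4" using D2(1) by (simp add: algebra_simps power2_eq_square)
      then show ?thesis using \<open>3 * n + D > 0\<close> by (simp add: field_simps)
    qed
    have "(\<lambda>i. real_of_int k / n + inverse (real_of_int (c' (Suc i)) / c' i) / n)
        \<longlonglongrightarrow> real_of_int k / n + inverse ((3 * n + D) / 2) / n"
      using \<open>3 * n + D > 0\<close> pos
      by (intro tendsto_add tendsto_const tendsto_divide tendsto_inverse lim') simp_all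
    moreover have "real_of_int k / n + inverse ((3 * n + D) / 2) / n = real_of_int k / n + 1 / 2 * L"
      unfolding assms(5) D inv using pos by (simp add: field_simps)
    moreover have "real_of_int (a' (Suc i)) / c' (Suc i)
        = real_of_int k / n + inverse (real_of_int (c' (Suc i)) / c' i) / n" for i
      using ratio'[of "Suc i"] by simp
    ultimately show "(\<lambda>i. real_of_int (a' (Suc i)) / real_of_int (c' (Suc i)))
        \<longlonglongrightarrow> real_of_int k / real_of_int n + 1 / 2 * L"
      by (simp only:)
  qed

  have triples: "ordered_markov_triple (c i) (c (i + 1)) n (G i) (G (i + 1)) H" if "i \<ge> 1" for i
  proof -
    have "X (i + 1) = mediant (X i, w)" using that by (cases i) (simp_all add: X_def)
    moreover have "tree_edge (X i) w" unfolding X_def by (rule tree_edge_left_fan[OF tl])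
    ultimately show ?thesis
      using tree_edge_ordered_triple[of "X i" w] X(1)[OF that] X(1)[of "i + 1"]
      unfolding G_def Hw by (simp add: w del: mediant.simps vertex_farey.simps)
  qed
  have triples': "ordered_markov_triple n (c' (i + 1)) (c' i) H (G' (i + 1)) (G' i)" if "i \<ge> 1" for i
  proof -
    have "Y (i + 1) = mediant (w, Y i)" using that by (cases i) (simp_all add: Y_def)
    moreover have "tree_edge w (Y i)" unfolding Y_def by (rule tree_edge_right_fan[OF tr])
    ultimately show ?thesis
      using tree_edge_ordered_triple[of w "Y i"] Y(1)[OF that] Y(1)[of "i + 1"]
      unfolding G'_def Hw by (simp add: w del: mediant.simps vertex_farey.simps)
  qed
  have fm: "fm_label z = of_int (vertex_fm_num z) / of_int (vertex_markov z)" for z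
    by (cases z) auto
  have labels: "of_int (a i) / of_int (c i) = 3 + lambda_FM (G i)" if "i \<ge> 1" for i
  proof -
    have "lambda_FM (G i) = of_int (vertex_fm_num (X i)) / of_int (c i)"
      using tree_edge_labels(3)[OF tree_edge_left_fan[OF tl, of "i - 1"]] X(1)[OF that]
      by (simp add: G_def X_def fm)
    then show ?thesis using c_pos[of i] by (simp add: a_def add_divide_distrib)
  qed
  have labels': "of_int (a' i) / of_int (c' i) = lambda_FM (G' i)" if "i \<ge> 1" for i
    using tree_edge_labels(4)[OF tree_edge_right_fan[OF tr, of "i - 1"]] Y(1)[OF that]
    by (simp add: G'_def Y_def fm a'_def)

  have c1: "c 1 = n1" by (simp add: c_def)
  have a1: "a 1 = 3 * n1 + k1" by (simp add: a_def c_def X_def uv k)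
  have c'1: "c' 1 = n2" and a'1: "a' 1 = k2" by (simp_all add: c'_def a'_def Y_def uv k)
  have start: "real_of_int (a 1) / real_of_int (c 1) = 3 + real_of_int k1 / real_of_int n1"
    unfolding a1 c1 using pos by (simp add: add_divide_distrib)
  have start': "real_of_int (a' 1) / real_of_int (c' 1) = real_of_int k2 / real_of_int n2"
    unfolding a'1 c'1 ..
  have a1_formula: "real_of_int (a 1) = 3 * real_of_int n1
      + (real_of_int k * real_of_int n1 - real_of_int n2) / real_of_int n"
  proof -
    have "real_of_int k * real_of_int n1 - real_of_int n2 = real_of_int k1 * real_of_int n"
      using arg_cong[OF r1, of real_of_int] by simp
    then show ?thesis unfolding a1 using pos by simp
  qed
  \<comment> \<open>Up to the summand \<open>k / n\<close>, the left side is \<open>(3 * n - n2 / n1) / n\<close>, and \<open>n2 < n\<close>.\<close>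
  have mid: "real_of_int (a 1) / c 1 \<ge> 3 / 2 + real_of_int k / n"
  proof -
    have "3 * n * n1 \<le> 2 * c 2"
    proof -
      have "n \<le> n * n1" using pos by simp
      then have "n2 \<le> n * n1" using less(2) by linarith
      then show ?thesis using pos by (simp add: c_def numeral_2_eq_2)
    qed
    then have "real_of_int (3 * n * n1) \<le> real_of_int (2 * c 2)" by (simp only: of_int_le_iff)
    then have "(real_of_int (c 2) / n1) / n \<ge> 3 / 2" using pos by (simp add: field_simps)
    moreover have "real_of_int (a 1) / c 1 = real_of_int k / n + (real_of_int (c 2) / n1) / n"
      using ratio[of 1] unfolding c1 one_add_one by simp
    ultimately show ?thesis by linarith
  qed
  \<comment> \<open>Up to the summand \<open>k / n\<close>, the right sequence starts at \<open>(n1 / n2) / n < 1\<close>, and it decreases.\<close>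
  have below: "real_of_int (a' i) / c' i < 3 / 2 + real_of_int k / n" if "i \<ge> 1" for i
    using that
  proof (induction i rule: dec_induct)
    case base
    have "n \<le> n * n2" using pos by simp
    then have "n1 < n * n2" using less(1) by linarith
    then have "real_of_int n1 < real_of_int (n * n2)" by (simp only: of_int_less_iff)
    then have "(real_of_int n1 / n2) / n < 1" using pos by (simp add: field_simps)
    moreover have "real_of_int (a' 1) / c' 1 = real_of_int k / n + (real_of_int n1 / n2) / n"
      using ratio'[of 1] unfolding c'1 by (simp add: c'_def)
    ultimately show ?case by linarith
  next
    case (step i)
    then show ?case using dec[of i] by simp
  qed
  have above: "real_of_int (a 1) / c 1 < real_of_int (a (Suc i)) / c (Suc i)" if "i \<ge> 1" for i
    using that
  proof (induction i rule: dec_induct)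
    case base
    then show ?case using inc[of 1] by simp
  next
    case (step i)
    then show ?case using inc[of "Suc i"] by simp
  qed
  have minimal: "real_of_int (a 1) / c 1 < real_of_int x / y"
    if xy: "(x, y) \<in> integral_solutions n k" "y \<noteq> 0" "real_of_int x / y \<ge> 3 / 2 + real_of_int k / n"
      "(x, y) \<noteq> (a 1, c 1)" "(x, y) \<noteq> (- a 1, - c 1)" for x y
  proof -
    obtain s i where si: "s = 1 \<or> s = -1" "1 \<le> i"
      "(x, y) = (s * a i, s * c i) \<or> (x, y) = (s * a' i, s * c' i)"
        using all_sol[OF xy(1,2)] by blast
    then have q: "real_of_int x / y = real_of_int (a i) / c i \<and> x = s * a i \<and> y = s * c i
        \<or> real_of_int x / y = real_of_int (a' i) / c' i"
      by auto
    then have xa: "real_of_int x / y = real_of_int (a i) / c i" "x = s * a i" "y = s * c i"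
      using below[OF si(2)] xy(3) by linarith+
    then have "i \<noteq> 1" using xy(4,5) si(1) by auto
    then obtain j where "i = Suc j" "j \<ge> 1" using si(2) by (cases i) auto
    then show ?thesis using above[of j] xa(1) by simp
  qed

  show ?thesis
   
      by (rule exI[of _ a], rule exI[of _ c], rule exI[of _ a'], rule exI[of _ c'], rule exI[of _ G], rule exI[of _ G'])
      (use set_eq start inc lim_a triples labels start' dec lim_a' triples' labels' c1 a1_formula
        sol[of 1] mid minimal in \<open>simp only: case_prod_beta, blast\<close>)
qed

end
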